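(* Let $J$ be a Jacobi operator with perturbation $q\in\mathfrak X_k$, $k\in\{2p-1,2p\}$. Let its Jost function $\psi_0$ have $\mathfrak N=n_++n_-$ roots in $\mathbb D=\{|z|<1\}$, where $n_+$ (resp. $n_-$) is the number of positive (resp. negative) ones, and let $r_o$ be a resonance of $J$. Then the maximal possible multiplicity of $r_o$ equals $M$, where $M$ is given by: i) if $k=2p$ and $a_p<1$, then $$M=\begin{cases}p-\mathfrak N,& r_o\in\mathbb C\setminus\mathbb R,\\ \min(2p-2\mathfrak N+1,\,2p),& r_o\in\mathbb R;\end{cases}$$ ii) if $k=2p$ and $a_p>1$, then $$M=\begin{cases}p+1-\max(n_+,1)-\max(n_-,1),& r_o\in\mathbb C\setminus\mathbb R,\\ 2p+3-2\max(n_+,1)-2\max(n_-,1),& r_o\in\mathbb R;\end{cases}$$ iii) if $k=2p-1$ and $b_p>0$, then $$M=\begin{cases}p-\max(n_+,1)-n_-,& r_o\in\mathbb C\setminus\mathbb R,\\ 2p+1-2\max(n_+,1)-2n_-,& r_o\in\mathbb R;\end{cases}$$ iv) if $k=2p-1$ and $b_p<0$, then $$M=\begin{cases}p-\max(n_-,1)-n_+,& r_o\in\mathbb C\setminus\mathbb R,\\ 2p+1-2\max(n_-,1)-2n_+,& r_o\in\mathbb R.\end{cases}$$ A complex (non-real) resonance of the maximal multiplicity can be located at any point of $\mathbb C\setminus(\mathbb R\cup\overline{\mathbb D})$. If $-1<s_{-n_-}<\dots<s_{-1}<0<s_1<\dots<s_{n_+}<1$ are the roots of $\psi_0$ in $\mathbb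 D$, then a real resonance of the maximal multiplicity can be located in any of the intervals $(s_j^{-1},s_{j-1}^{-1})$, $j=-n_-+1,\dots,-1,2,\dots,n_+$.
   Context: $\mathbb N=\{1,2,\dots\}$. For real bounded sequences $(a_x)_{x\ge1}$, $(b_x)_{x\ge1}$ with $a_x>0$, the Jacobi operator $J$ on $\ell^2(\mathbb N)$ is $(Jf)_x=a_xf_{x+1}+b_xf_x+a_{x-1}f_{x-1}$, $x\ge1$, with $f_0=0$ formally and $a_0=1$. Its perturbation is $q=q(a,b)=(b_1,a_1-1,b_2,a_2-1,\dots)$. For $k\in\mathbb N$, $\mathfrak X_k=\{h\in\ell^\infty(\mathbb N)\ \text{real}:\ h_{2x}>-1\ \forall x\in\mathbb N,\ h_k\ne0,\ h_x=0\ \forall x>k\}$. So if $k\in\{2p-1,2p\}$ then $a_x=1,b_x=0$ for $x>p$; if $k=2p-1$ then $a_p=1,b_p\neq0$; if $k=2p$ then $a_p\ne1$. The Jost solution $(\psi_x(z))_{x\ge0}$, $z\ne0$, is defined by $a_{x-1}\psi_{x-1}+a_x\psi_{x+1}+b_x\psi_x=(z+z^{-1})\psi_x$ for $x\ge1$ and $\psi_x(z)=z^x$ for $x>p$. The Jost function $\psi_0$ is a real polynomial of degree $k$ with $\psi_0(0)>0$; its zeros in $\mathbb D$ are real and simple. Its zeros in $\mathbb C\setminus\mathbb D$ are called resonances; the multiplicity of a resonance is its multiplicity as a zero of $\psi_0$. "Maximal possible" refers to all operators $J$ with the given $k$, the given case (i)–(iv), and the given $n_+,n_-$.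
   Formalization: For real r_o the maximum is min(M, k−𝔑), since ψ_0 has only k−𝔑 zeros outside the disc; this lowers the printed M by one, where it is impossible, only in ii) with n_+=n_-=1, iii) with n_+=1, n_-=0, and iv) with n_+=0, n_-=1. *)

theory Defs
  imports "HOL-Analysis.Analysis" "HOL-Computational_Algebra.Polynomial"
begin

(* Sequences indexed by {1,2,...} are functions on nat whose value at 0 is irrelevant, except that
   a 0 = 1 is required. A Jacobi operator J is represented by its coefficients (a, b). *)

definition jacobi_coeffs :: "(nat \<Rightarrow> real) \<Rightarrow> (nat \<Rightarrow> real) \<Rightarrow> bool" where
  "jacobi_coeffs a b \<longleftrightarrow>
     a 0 = 1 \<and> (\<forall>x\<ge>1. a x > 0) \<and> bounded (a ` {1..}) \<and> bounded (b ` {1..})"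

(* The formal difference expression, used for x >= 1; J is its restriction to square-summable f
   with f 0 = 0. The Jost solution satisfies the same expression without f 0 = 0. *)
definition jacobi_expr ::
    "(nat \<Rightarrow> real) \<Rightarrow> (nat \<Rightarrow> real) \<Rightarrow> (nat \<Rightarrow> complex) \<Rightarrow> nat \<Rightarrow> complex" where
  "jacobi_expr a b f x =
     of_real (a x) * f (x + 1) + of_real (b x) * f x + of_real (a (x - 1)) * f (x - 1)"

(* q = (b 1, a 1 - 1, b 2, a 2 - 1, ...), with first index 1. *)
definition perturbation :: "(nat \<Rightarrow> real) \<Rightarrow> (nat \<Rightarrow> real) \<Rightarrow> nat \<Rightarrow> real" where
  "perturbation a b x = (if even x then a (x div 2) - 1 else b ((x + 1) div 2))"

definition pert_space :: "nat \<Rightarrow> (nat \<Rightarrow> real) set" where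
  "pert_space k = {h. bounded (h ` {1..}) \<and> (\<forall>x\<ge>1. h (2 * x) > -1) \<and>
                      h k \<noteq> 0 \<and> (\<forall>x>k. h x = 0)}"

definition is_jost_solution ::
    "(nat \<Rightarrow> real) \<Rightarrow> (nat \<Rightarrow> real) \<Rightarrow> nat \<Rightarrow> complex \<Rightarrow> (nat \<Rightarrow> complex) \<Rightarrow> bool" where
  "is_jost_solution a b p z \<psi> \<longleftrightarrow>
     (\<forall>x\<ge>1. jacobi_expr a b \<psi> x = (z + inverse z) * \<psi> x) \<and> (\<forall>x>p. \<psi> x = z ^ x)"

definition jost_solution ::
    "(nat \<Rightarrow> real) \<Rightarrow> (nat \<Rightarrow> real) \<Rightarrow> nat \<Rightarrow> complex \<Rightarrow> nat \<Rightarrow> complex" where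
  "jost_solution a b p z = (THE \<psi>. is_jost_solution a b p z \<psi>)"

(* psi_0 as a polynomial; this also gives it a value at z = 0, where the solution is not defined.
   That both descriptions are proper is jost_solution_ex1 and jost_function_ex1 below. *)
definition jost_function :: "(nat \<Rightarrow> real) \<Rightarrow> (nat \<Rightarrow> real) \<Rightarrow> nat \<Rightarrow> complex poly" where
  "jost_function a b p = (THE P. \<forall>z. z \<noteq> 0 \<longrightarrow> poly P z = jost_solution a b p z 0)"

definition disc_roots :: "(nat \<Rightarrow> real) \<Rightarrow> (nat \<Rightarrow> real) \<Rightarrow> nat \<Rightarrow> complex set" where
  "disc_roots a b p = {z. norm z < 1 \<and> poly (jost_function a b p) z = 0}"

definition resonances :: "(nat \<Rightarrow> real) \<Rightarrow> (nat \<Rightarrow> real) \<Rightarrow> nat \<Rightarrow> complex set" where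
  "resonances a b p = {z. norm z \<ge> 1 \<and> poly (jost_function a b p) z = 0}"

definition multiplicity_of :: "(nat \<Rightarrow> real) \<Rightarrow> (nat \<Rightarrow> real) \<Rightarrow> nat \<Rightarrow> complex \<Rightarrow> int" where
  "multiplicity_of a b p r = int (order r (jost_function a b p))"

datatype pert_type = A_below | A_above | B_pos | B_neg

fun has_type ::
    "pert_type \<Rightarrow> nat \<Rightarrow> nat \<Rightarrow> (nat \<Rightarrow> real) \<Rightarrow> (nat \<Rightarrow> real) \<Rightarrow> bool" where
  "has_type A_below k p a b \<longleftrightarrow> k = 2 * p \<and> a p < 1"
| "has_type A_above k p a b \<longleftrightarrow> k = 2 * p \<and> a p > 1"
| "has_type B_pos k p a b \<longleftrightarrow> k = 2 * p - 1 \<and> b p > 0"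
| "has_type B_neg k p a b \<longleftrightarrow> k = 2 * p - 1 \<and> b p < 0"

(* The operators among which multiplicities are compared. Roots in the disc are real and simple,
   so that counting distinct real roots is counting all of them. *)
definition jacobi_class ::
    "pert_type \<Rightarrow> nat \<Rightarrow> nat \<Rightarrow> nat \<Rightarrow> nat \<Rightarrow> (nat \<Rightarrow> real) \<Rightarrow> (nat \<Rightarrow> real) \<Rightarrow> bool" where
  "jacobi_class c k p np nm a b \<longleftrightarrow>
     jacobi_coeffs a b \<and> perturbation a b \<in> pert_space k \<and> has_type c k p a b \<and>
     card {s::real. s > 0 \<and> of_real s \<in> disc_roots a b p} = np \<and>
     card {s::real. s < 0 \<and> of_real s \<in> disc_roots a b p} = nm"

definition is_max_multiplicity ::
    "pert_type \<Rightarrow> nat \<Rightarrow> nat \<Rightarrow> nat \<Rightarrow> nat \<Rightarrow> complex set \<Rightarrow> int \<Rightarrow> bool" where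
  "is_max_multiplicity c k p np nm A m \<longleftrightarrow>
     (\<exists>a b r. jacobi_class c k p np nm a b \<and> r \<in> resonances a b p \<inter> A \<and>
              multiplicity_of a b p r = m) \<and>
     (\<forall>a b r. jacobi_class c k p np nm a b \<and> r \<in> resonances a b p \<inter> A \<longrightarrow>
              multiplicity_of a b p r \<le> m)"

fun M_nonreal :: "pert_type \<Rightarrow> int \<Rightarrow> int \<Rightarrow> int \<Rightarrow> int" where
  "M_nonreal A_below p np nm = p - (np + nm)"
| "M_nonreal A_above p np nm = p + 1 - max np 1 - max nm 1"
| "M_nonreal B_pos p np nm = p - max np 1 - nm"
| "M_nonreal B_neg p np nm = p - max nm 1 - np"

(* In three configurations this exceeds by one the number k - (np + nm) of zeros of psi_0 outside
   the disc: A_above with (np, nm) = (1, 1), B_pos with (1, 0), B_neg with (0, 1). Elsewhere it is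
   at most that number. The theorem therefore takes the minimum with k - (np + nm), which changes
   the value in these three configurations only. *)
fun M_real :: "pert_type \<Rightarrow> int \<Rightarrow> int \<Rightarrow> int \<Rightarrow> int" where
  "M_real A_below p np nm = min (2 * p - 2 * (np + nm) + 1) (2 * p)"
| "M_real A_above p np nm = 2 * p + 3 - 2 * max np 1 - 2 * max nm 1"
| "M_real B_pos p np nm = 2 * p + 1 - 2 * max np 1 - 2 * nm"
| "M_real B_neg p np nm = 2 * p + 1 - 2 * max nm 1 - 2 * np"

(* s (-nm) < ... < s (-1) < 0 < s 1 < ... < s np are the roots in the disc; s 0 plays no role. *)
definition enumerates_disc_roots ::
    "(nat \<Rightarrow> real) \<Rightarrow> (nat \<Rightarrow> real) \<Rightarrow> nat \<Rightarrow> nat \<Rightarrow> nat \<Rightarrow> (int \<Rightarrow> real) \<Rightarrow> bool" where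
  "enumerates_disc_roots a b p np nm s \<longleftrightarrow>
     strict_mono_on ({- int nm..int np} - {0}) s \<and>
     (\<forall>j\<in>{- int nm..-1}. -1 < s j \<and> s j < 0) \<and> (\<forall>j\<in>{1..int np}. 0 < s j \<and> s j < 1) \<and>
     disc_roots a b p = (\<lambda>j. of_real (s j)) ` ({- int nm..int np} - {0})"

lemma jost_solution_unique:
  assumes "jacobi_coeffs a b" "is_jost_solution a b p z \<psi>" "is_jost_solution a b p z \<phi>"
  shows "\<psi> = \<phi>"
proof -
  have pos: "a x > 0" for x
    using assms(1) by (cases x) (auto simp: jacobi_coeffs_def)
  have "d \<le> p + 1 \<Longrightarrow> \<forall>x \<ge> p + 1 - d. \<psi> x = \<phi> x" for d
  proof (induction d)
    case 0
    then show ?case using assms(2,3) by (auto simp: is_jost_solution_def)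
  next
    case (Suc d)
    define m where "m = p + 1 - Suc d"
    have m: "p + 1 - d = Suc m" using Suc.prems by (auto simp: m_def)
    have IH: "\<psi> x = \<phi> x" if "x \<ge> Suc m" for x using Suc that m by auto
    have "jacobi_expr a b f (Suc m) = (z + inverse z) * f (Suc m)" if "f \<in> {\<psi>, \<phi>}" for f
      using assms(2,3) that by (auto simp: is_jost_solution_def)
    from this[of \<psi>] this[of \<phi>] have "of_real (a m) * \<psi> m = of_real (a m) * \<phi> m"
      using IH[of "Suc m"] IH[of "Suc (Suc m)"]
      by (simp add: jacobi_expr_def) (metis add_left_cancel mult_cancel_left of_real_eq_0_iff)
    hence "\<psi> m = \<phi> m" using pos[of m] by simp
    thus ?case using IH m_def by (metis le_eq_less_or_eq Suc_leI)
  qed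
  from this[of "p + 1"] show ?thesis by auto
qed

lemma jost_solution_poly_ex:
  assumes J: "jacobi_coeffs a b" and fin: "\<And>x. x > p \<Longrightarrow> a x = 1 \<and> b x = 0"
  shows "\<exists>Q::nat \<Rightarrow> complex poly. \<forall>z. z \<noteq> 0 \<longrightarrow> is_jost_solution a b p z (\<lambda>x. z ^ x * poly (Q x) z)"
proof -
  have pos: "a x > 0" for x
    using J by (cases x) (auto simp: jacobi_coeffs_def)
  define R where "R Q x \<longleftrightarrow> (\<forall>z. of_real (a x) * poly (Q x) z =
      (1 + z\<^sup>2 - of_real (b (Suc x)) * z) * poly (Q (Suc x)) z
      - of_real (a (Suc x)) * z\<^sup>2 * poly (Q (Suc (Suc x))) z)"
    for Q :: "nat \<Rightarrow> complex poly" and x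
  have "d \<le> p + 1 \<Longrightarrow> \<exists>Q. (\<forall>x>p. Q x = 1) \<and> (\<forall>x \<ge> p + 1 - d. R Q x)" for d
  proof (induction d)
    case 0
    show ?case by (rule exI[of _ "\<lambda>_. 1"]) (auto simp: R_def fin)
  next
    case (Suc d)
    define m where "m = p + 1 - Suc d"
    have m: "p + 1 - d = Suc m" "m \<le> p" using Suc.prems by (auto simp: m_def)
    obtain Q where Q: "\<forall>x>p. Q x = 1" "\<forall>x\<ge>Suc m. R Q x" using Suc m by auto
    define Q' where "Q' = Q(m := smult (inverse (of_real (a m)))
       ([:1, - of_real (b (Suc m)), 1:] * Q (Suc m)
        - smult (of_real (a (Suc m))) ([:0, 0, 1:] * Q (Suc (Suc m)))))"
    have "R Q' m" using pos[of m]
      by (simp add: R_def Q'_def field_simps power2_eq_square)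
    moreover have "R Q' x" if "x \<ge> Suc m" for x
      using Q(2) that by (auto simp: R_def Q'_def)
    ultimately have "R Q' x" if "x \<ge> m" for x using that by (metis le_eq_less_or_eq Suc_leI)
    moreover have "\<forall>x>p. Q' x = 1" using Q(1) m(2) by (auto simp: Q'_def)
    ultimately show ?case using m_def by blast
  qed
  from this[of "p + 1"] obtain Q where Q: "\<forall>x>p. Q x = 1" "\<And>x. R Q x" by auto
  have "is_jost_solution a b p z (\<lambda>x. z ^ x * poly (Q x) z)" if "z \<noteq> 0" for z
    unfolding is_jost_solution_def
  proof (intro conjI allI impI)
    fix x :: nat assume "x \<ge> 1"
    then obtain m where m: "x = Suc m" by (cases x) auto
    have eq: "of_real (a m) * poly (Q m) z =
      (1 + z\<^sup>2 - of_real (b (Suc m)) * z) * poly (Q (Suc m)) z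
      - of_real (a (Suc m)) * z\<^sup>2 * poly (Q (Suc (Suc m))) z"
      using Q(2)[of m] by (simp add: R_def)
    have "jacobi_expr a b (\<lambda>x. z ^ x * poly (Q x) z) x =
      z ^ m * (of_real (a (Suc m)) * z\<^sup>2 * poly (Q (Suc (Suc m))) z
        + of_real (b (Suc m)) * z * poly (Q (Suc m)) z + of_real (a m) * poly (Q m) z)"
      by (simp add: jacobi_expr_def m algebra_simps power2_eq_square)
    also have "\<dots> = z ^ m * ((1 + z\<^sup>2) * poly (Q (Suc m)) z)"
      by (simp add: eq algebra_simps)
    also have "\<dots> = (z + inverse z) * (z ^ x * poly (Q x) z)"
      using that by (simp add: m field_simps power2_eq_square)
    finally show "jacobi_expr a b (\<lambda>x. z ^ x * poly (Q x) z) x =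
      (z + inverse z) * (z ^ x * poly (Q x) z)" .
  qed (use Q(1) in auto)
  thus ?thesis by blast
qed

lemma pert_space_tail:
  assumes "perturbation a b \<in> pert_space k" "k \<in> {2 * p - 1, 2 * p}" "x > p"
  shows "a x = 1 \<and> b x = 0"
proof -
  have "perturbation a b (2 * x) = 0" "perturbation a b (2 * x - 1) = 0"
    using assms by (auto simp: pert_space_def)
  thus ?thesis using assms(3) by (auto simp: perturbation_def split: if_splits)
qed

lemma jost_solution_ex1:
  assumes "jacobi_coeffs a b" "perturbation a b \<in> pert_space k" "k \<in> {2 * p - 1, 2 * p}" "z \<noteq> 0"
  shows "\<exists>!\<psi>. is_jost_solution a b p z \<psi>"
  using jost_solution_poly_ex[of a b p] jost_solution_unique[of a b p z]
    pert_space_tail[OF assms(2,3)] assms(1,4) by blast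

lemma jost_function_ex1:
  assumes "jacobi_coeffs a b" "perturbation a b \<in> pert_space k" "k \<in> {2 * p - 1, 2 * p}"
  shows "\<exists>!P. \<forall>z. z \<noteq> 0 \<longrightarrow> poly P z = jost_solution a b p z 0"
proof -
  obtain Q where Q: "\<forall>z. z \<noteq> 0 \<longrightarrow> is_jost_solution a b p z (\<lambda>x. z ^ x * poly (Q x) z)"
    using jost_solution_poly_ex[of a b p] assms(1) pert_space_tail[OF assms(2,3)] by blast
  have "jost_solution a b p z = (\<lambda>x. z ^ x * poly (Q x) z)" if "z \<noteq> 0" for z
    unfolding jost_solution_def
    using Q that jost_solution_ex1[OF assms that] by (intro the1_equality) auto
  hence ex: "\<forall>z. z \<noteq> 0 \<longrightarrow> poly (Q 0) z = jost_solution a b p z 0" by simp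
  show ?thesis
  proof (rule ex1I[of _ "Q 0"], rule ex)
    fix P assume P: "\<forall>z. z \<noteq> 0 \<longrightarrow> poly P z = jost_solution a b p z 0"
    show "P = Q 0"
    proof (rule ccontr)
      assume "P \<noteq> Q 0"
      hence "finite {z. poly (P - Q 0) z = 0}" by (intro poly_roots_finite) simp
      moreover have "UNIV - {0} \<subseteq> {z. poly (P - Q 0) z = 0}" using P ex by auto
      ultimately have "finite (UNIV - {0::complex})" by (rule rev_finite_subset)
      thus False by (simp add: infinite_UNIV_char_0)
    qed
  qed
qed

end

theory Submission
  imports Defs "HOL-Complex_Analysis.Residue_Theorem"
begin

text \<open>The possible multiplicities are limited by the real zeros that the Jost function f = \<psi>_0 cannot
avoid, and nothing else limits them. Three facts make this precise.

A sign rule. The function f is a real polynomial of degree k with f(0) > 0, and the sign of its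
leading coefficient is that of 1 - a_p if k = 2p and that of -b_p if k = 2p - 1. At a zero s of f in
(-1,1) one has s f'(s) f(1/s) > 0 (jost_disc_zero_sign): letting z tend to s in the
Christoffel-Darboux identity for \<psi>(z) and \<psi>(s) gives f'(s) \<psi>_1(s) < 0, and the constancy of the
Wronskian of \<psi>(s) and \<psi>(1/s) gives f(1/s) \<psi>_1(s) = s - 1/s. In particular these zeros are simple.

Counting. Let 0 < s_1 < ... < s_n be the positive zeros in the disc. As f' alternates in sign
along them, so do the values f(1/s_j), and f vanishes in every interval (1/s_j, 1/s_(j-1)); comparing
the signs at 0, at 1/s_1 and at infinity decides whether there is one more zero. With the
mirror-image statement on the negative axis this forces a number z of distinct real zeros
(card_real_roots_ge). A nonreal resonance of multiplicity m comes with its conjugate, so 2m + z \<le> k;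
a real one may be one of the z zeros, so m + z - 1 \<le> k, and it lies outside the disc, so m is at most
k minus the number of zeros in the disc (multiplicity_bounds). These three inequalities are the
formulas for M.

The inverse problem. The sign rule is also sufficient: a real polynomial f of degree k with f(0) > 0
whose zeros in the closed disc are real, of modulus less than 1 and obey the sign rule is a positive
multiple of a Jost function (jost_like_realizable). The coefficients a, b come from orthogonal
polynomials. Let L be integration in \<lambda> = z + 1/z against the weight sin^2 / |f|^2 on the unit circle,
plus point masses at s + 1/s for the zeros s in the disc; the sign rule says exactly that the masses are
positive. The polynomials \<phi>_x in \<lambda> given by
(1/z - z) \<phi>_x(\<lambda>) = f(z) z^(-x) - f(1/z) z^x are, for x > p, orthogonal for L by the residue theorem,
and they satisfy the free recurrence. Running the three-term recurrence downwards from \<phi>_(p+2) and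
\<phi>_(p+1) stays within orthogonal polynomials, and positivity of L makes every a_x positive
(downward_recursion). The resulting solution \<phi> vanishes at 0, and its Wronskian with the Jost
solution is a positive multiple of \<psi>_0 at x = 0 and equals f beyond p.

It remains to write down extremal polynomials: the product of 1 - z/x over the prescribed zeros in
the disc and over one outer zero in each place where one is forced, times an even power or a power
of a positive quadratic that carries the excess multiplicity (balanced_zeros_exist,
nonreal_resonance_attained, real_resonance_attained).\<close>

section \<open>Real polynomials as complex polynomials\<close>

abbreviation cpoly :: "real poly \<Rightarrow> complex poly" where
  "cpoly \<equiv> map_poly of_real"

lemma cpoly_mult: "cpoly (f * g) = cpoly f * cpoly g"
  by (rule poly_eqI) (simp add: coeff_map_poly coeff_mult)

lemma cpoly_diff: "cpoly (f - g) = cpoly f - cpoly g"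
  by (rule poly_eqI) (simp add: coeff_map_poly)

lemma cpoly_sum: "cpoly (\<Sum>x\<in>A. f x) = (\<Sum>x\<in>A. cpoly (f x))"
  by (rule poly_eqI) (simp add: coeff_map_poly coeff_sum)

lemma cpoly_smult: "cpoly (smult c f) = smult (of_real c) (cpoly f)"
  by (rule poly_eqI) (simp add: coeff_map_poly)

lemma cpoly_power: "cpoly (f ^ n) = cpoly f ^ n"
  by (induction n) (auto simp: cpoly_mult)

lemma cpoly_prod: "cpoly (\<Prod>x\<in>A. f x) = (\<Prod>x\<in>A. cpoly (f x))"
  by (induction A rule: infinite_finite_induct) (auto simp: cpoly_mult)

lemma degree_cpoly: "degree (cpoly f) = degree f"
  by (rule degree_map_poly) auto

lemma cpoly_eq_0_iff: "cpoly f = 0 \<longleftrightarrow> f = 0"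
  by (rule map_poly_eq_0_iff) auto

lemma poly_cpoly_altdef: "poly (cpoly f) z = (\<Sum>i\<le>degree f. of_real (coeff f i) * z ^ i)"
  by (simp add: poly_altdef degree_cpoly coeff_map_poly)

lemma poly_cpoly_of_real: "poly (cpoly f) (of_real x) = of_real (poly f x)"
  unfolding poly_cpoly_altdef by (simp add: poly_altdef)

lemma poly_cpoly_X: "poly (cpoly [:0, 1:]) z = z"
  by (simp add: map_poly_pCons)

lemma poly_cpoly_cnj: "poly (cpoly f) (cnj z) = cnj (poly (cpoly f) z)"
  by (simp add: poly_cpoly_altdef)

lemma real_poly_eqI:
  fixes f g :: "real poly"
  assumes "l < u" "\<And>z. l < z \<Longrightarrow> z < u \<Longrightarrow> poly f z = poly g z"
  shows "f = g"
proof (rule ccontr)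
  assume "f \<noteq> g"
  hence "finite {z. poly (f - g) z = 0}" by (intro poly_roots_finite) simp
  moreover have "{l<..<u} \<subseteq> {z. poly (f - g) z = 0}" using assms by auto
  ultimately have "finite {l<..<u}" by (rule rev_finite_subset)
  moreover have "infinite {l<..<u}" using assms(1) by (rule infinite_Ioo)
  ultimately show False by simp
qed

section \<open>The Jost function as a real polynomial\<close>

text \<open>The Jost solution is \<psi>_x(z) = z^x Q_x(z) with polynomials Q_x, and Q_0 is the Jost function. The
clauses below are its difference equation divided by z^x and solved for Q_x, starting from Q_x = 1
beyond the support of the perturbation.\<close>

function jost_factor :: "(nat \<Rightarrow> real) \<Rightarrow> (nat \<Rightarrow> real) \<Rightarrow> nat \<Rightarrow> nat \<Rightarrow> real poly" where
  "jost_factor a b p x = (if x > p then 1 else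
     smult (inverse (a x)) ([:1, - b (Suc x), 1:] * jost_factor a b p (Suc x)
       - smult (a (Suc x)) ([:0, 0, 1:] * jost_factor a b p (Suc (Suc x)))))"
  by pat_completeness auto
termination by (relation "Wellfounded.measure (\<lambda>(a, b, p, x). p + 1 - x)") auto

declare jost_factor.simps [simp del]

lemma jacobi_coeffs_pos: "jacobi_coeffs a b \<Longrightarrow> a x > 0"
  by (cases x) (auto simp: jacobi_coeffs_def)

lemma jost_factor_beyond: "x > p \<Longrightarrow> jost_factor a b p x = 1"
  by (simp add: jost_factor.simps)

text \<open>Beyond p the recursion holds because it reads 1 = (1 + z^2) - z^2 there, so one formula serves all x.\<close>

lemma jost_factor_rec:
  assumes "\<And>x. a x > 0" "\<forall>x>p. a x = 1 \<and> b x = 0"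
  shows "smult (a x) (jost_factor a b p x) =
    [:1, - b (Suc x), 1:] * jost_factor a b p (Suc x)
       - smult (a (Suc x)) ([:0, 0, 1:] * jost_factor a b p (Suc (Suc x)))"
proof (cases "x > p")
  case True
  thus ?thesis using assms(2)[rule_format, of x] assms(2)[rule_format, of "Suc x"] by (simp add: jost_factor_beyond one_pCons)
next
  case False
  thus ?thesis using assms(1)[of x] by (subst jost_factor.simps) simp
qed

lemma jost_factor_solves:
  fixes z :: complex
  assumes pos: "\<And>x. a x > 0" and fin: "\<forall>x>p. a x = 1 \<and> b x = 0"
    and "z \<noteq> 0" and u: "\<And>x. u x = z ^ x * poly (cpoly (jost_factor a b p x)) z"
    and "x \<ge> 1"
  shows "of_real (a x) * u (x + 1) + of_real (b x) * u x + of_real (a (x - 1)) * u (x - 1)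
    = (z + inverse z) * u x"
proof -
  obtain m where m: "x = Suc m" using \<open>x \<ge> 1\<close> by (cases x) auto
  define Q where "Q y = poly (cpoly (jost_factor a b p y)) z" for y
  have eq: "of_real (a m) * Q m = (1 - of_real (b (Suc m)) * z + z\<^sup>2) * Q (Suc m)
      - of_real (a (Suc m)) * (z\<^sup>2 * Q (Suc (Suc m)))"
    using arg_cong[OF jost_factor_rec[of a p b m, OF pos fin], of "\<lambda>f. poly (cpoly f) z"]
    unfolding cpoly_mult cpoly_diff cpoly_smult Q_def
    by (simp add: map_poly_pCons algebra_simps power2_eq_square)
  have uQ: "u y = z ^ y * Q y" for y by (simp add: u Q_def)
  have "of_real (a x) * u (x + 1) + of_real (b x) * u x + of_real (a (x - 1)) * u (x - 1) =
      z ^ m * (of_real (a (Suc m)) * (z\<^sup>2 * Q (Suc (Suc m)))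
        + of_real (b (Suc m)) * z * Q (Suc m) + of_real (a m) * Q m)"
    by (simp add: uQ m algebra_simps power2_eq_square)
  also have "\<dots> = z ^ m * ((1 + z\<^sup>2) * Q (Suc m))"
    unfolding eq by (simp add: algebra_simps)
  also have "\<dots> = (z + inverse z) * u x"
    using \<open>z \<noteq> 0\<close> by (simp add: m uQ field_simps power2_eq_square)
  finally show ?thesis .
qed

lemma jost_function_eq_cpoly:
  assumes "jacobi_coeffs a b" "perturbation a b \<in> pert_space k" "k \<in> {2 * p - 1, 2 * p}"
  shows "jost_function a b p = cpoly (jost_factor a b p 0)"
proof -
  note pos = jacobi_coeffs_pos[OF assms(1)]
  have fin: "\<forall>x>p. a x = 1 \<and> b x = 0" using pert_space_tail[OF assms(2,3)] by blast
  have "is_jost_solution a b p z (\<lambda>x. z ^ x * poly (cpoly (jost_factor a b p x)) z)"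
    if "z \<noteq> 0" for z
    unfolding is_jost_solution_def jacobi_expr_def
    using jost_factor_solves[OF pos fin that refl] by (auto simp: jost_factor_beyond)
  hence "jost_solution a b p z = (\<lambda>x. z ^ x * poly (cpoly (jost_factor a b p x)) z)"
    if "z \<noteq> 0" for z
    unfolding jost_solution_def
    using that jost_solution_ex1[OF assms that] by (intro the1_equality) auto
  thus ?thesis unfolding jost_function_def
    using jost_function_ex1[OF assms] by (intro the1_equality) auto
qed

lemma degree_jost_factor:
  assumes pos: "\<And>x. a x > 0" and fin: "\<forall>x>p. a x = 1 \<and> b x = 0"
  shows "degree (jost_factor a b p x) \<le> 2 * (p - x)"
proof (induction "p + 1 - x" arbitrary: x rule: less_induct)
  case less
  let ?Q = "jost_factor a b p"
  note rec = jost_factor_rec[of a p b, OF pos fin]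
  consider "x > p" | "x = p" | "x < p" by linarith
  thus ?case
  proof cases
    case 1
    thus ?thesis by (simp add: jost_factor_beyond)
  next
    case 2
    have "smult (a p) (?Q p) = 1"
      using rec[of p] fin[rule_format, of "Suc p"] by (simp add: jost_factor_beyond one_pCons)
    hence "degree (smult (a p) (?Q p)) = 0" by simp
    thus ?thesis using pos[of p] 2 by simp
  next
    case 3
    have "degree ([:1, - b (Suc x), 1:] * ?Q (Suc x)
        - smult (a (Suc x)) ([:0, 0, 1:] * ?Q (Suc (Suc x)))) \<le> 2 * (p - x)"
    proof (rule degree_diff_le)
      have IH: "degree (?Q (Suc x)) \<le> 2 * (p - Suc x)"
        "degree (?Q (Suc (Suc x))) \<le> 2 * (p - Suc (Suc x))"
        using 3 by (auto intro!: less)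
      have "degree ([:1, - b (Suc x), 1:] * ?Q (Suc x)) \<le> 2 + 2 * (p - Suc x)"
        by (rule order_trans[OF degree_mult_le add_mono[OF _ IH(1)]]) simp
      thus "degree ([:1, - b (Suc x), 1:] * ?Q (Suc x)) \<le> 2 * (p - x)" using 3 by linarith
      have "degree ([:0, 0, 1:] * ?Q (Suc (Suc x))) \<le> 2 + 2 * (p - Suc (Suc x))"
        by (rule order_trans[OF degree_mult_le add_mono[OF _ IH(2)]]) simp
      hence "degree ([:0, 0, 1:] * ?Q (Suc (Suc x))) \<le> 2 * (p - x)" using 3 by linarith
      thus "degree (smult (a (Suc x)) ([:0, 0, 1:] * ?Q (Suc (Suc x)))) \<le> 2 * (p - x)"
        by (rule order_trans[OF degree_smult_le])
    qed
    hence "degree (smult (a x) (?Q x)) \<le> 2 * (p - x)" by (rule ssubst[OF rec[of x]])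
    thus ?thesis using pos[of x] by simp
  qed
qed

lemma jost_factor_coeff_rec:
  assumes pos: "\<And>x. a x > 0" and fin: "\<forall>x>p. a x = 1 \<and> b x = 0"
  defines "Q \<equiv> jost_factor a b p"
  shows "a x * coeff (Q x) 0 = coeff (Q (Suc x)) 0"
    and "a x * coeff (Q x) (Suc 0) = coeff (Q (Suc x)) 1 - b (Suc x) * coeff (Q (Suc x)) 0"
    and "a x * coeff (Q x) (Suc (Suc n)) = coeff (Q (Suc x)) (Suc (Suc n))
      - b (Suc x) * coeff (Q (Suc x)) (Suc n) + coeff (Q (Suc x)) n
      - a (Suc x) * coeff (Q (Suc (Suc x))) n"
proof -
  have eq: "a x * coeff (Q x) m = coeff ([:1, - b (Suc x), 1:] * Q (Suc x)) m
    - a (Suc x) * coeff ([:0, 0, 1:] * Q (Suc (Suc x))) m" for m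
    using arg_cong[OF jost_factor_rec[of a p b x, OF pos fin], of "\<lambda>q. coeff q m"]
    unfolding Q_def coeff_diff coeff_smult by simp
  show "a x * coeff (Q x) 0 = coeff (Q (Suc x)) 0"
    "a x * coeff (Q x) (Suc 0) = coeff (Q (Suc x)) 1 - b (Suc x) * coeff (Q (Suc x)) 0"
    "a x * coeff (Q x) (Suc (Suc n)) = coeff (Q (Suc x)) (Suc (Suc n))
      - b (Suc x) * coeff (Q (Suc x)) (Suc n) + coeff (Q (Suc x)) n
      - a (Suc x) * coeff (Q (Suc (Suc x))) n"
    by (simp_all add: eq)
qed

lemma jost_factor_const_pos:
  assumes pos: "\<And>x. a x > 0" and fin: "\<forall>x>p. a x = 1 \<and> b x = 0"
  shows "coeff (jost_factor a b p x) 0 > 0"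
proof (induction "p + 1 - x" arbitrary: x rule: less_induct)
  case less
  show ?case
  proof (cases "x > p")
    case True
    thus ?thesis by (simp add: jost_factor_beyond)
  next
    case False
    hence "coeff (jost_factor a b p (Suc x)) 0 > 0" by (intro less) auto
    hence "a x * coeff (jost_factor a b p x) 0 > 0"
      by (subst jost_factor_coeff_rec(1)[of a p b, OF pos fin])
    thus ?thesis using pos[of x] by (simp add: zero_less_mult_iff)
  qed
qed

text \<open>Below p the top coefficients are only multiplied by 1/a_x from one step to the next, because the term
with z^2 Q_(x+2) has too small a degree to contribute. The first step below p creates the factor
1 - a_p^2, and when it vanishes the next coefficient is -b_p up to a positive constant.\<close>

lemma jost_factor_top_coeffs:
  assumes pos: "\<And>x. a x > 0" and fin: "\<forall>x>p. a x = 1 \<and> b x = 0"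
    and "x + d = p" "d \<ge> 1"
  shows "\<exists>C>0. coeff (jost_factor a b p x) (2 * d) = C * (1 - (a p)\<^sup>2) \<and>
       (a p = 1 \<longrightarrow> coeff (jost_factor a b p x) (2 * d - 1) = - C * b p)"
  using \<open>d \<ge> 1\<close> \<open>x + d = p\<close>
proof (induction d arbitrary: x rule: dec_induct)
  case base
  note rec = jost_factor_coeff_rec[of a p b, OF pos fin]
  have x: "p = Suc x" using base by simp
  have Qp: "coeff (jost_factor a b p p) i = (if i = 0 then inverse (a p) else 0)" for i
  proof (cases i)
    case 0
    thus ?thesis using rec(1)[of p] pos[of p] by (simp add: jost_factor_beyond field_simps)
  next
    case (Suc j)
    thus ?thesis using degree_jost_factor[of a p b p, OF pos fin] by (simp add: coeff_eq_0)
  qed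
  have "a x * coeff (jost_factor a b p x) 2 = inverse (a p) - a p"
    using rec(3)[of x 0] Qp by (simp add: x[symmetric] jost_factor_beyond numeral_2_eq_2)
  moreover have "a x * coeff (jost_factor a b p x) 1 = - b p * inverse (a p)"
    using rec(2)[of x] Qp by (simp add: x[symmetric])
  ultimately show ?case using pos[of x] pos[of p]
    by (intro exI[of _ "inverse (a p * a x)"]) (auto simp: field_simps power2_eq_square numeral_2_eq_2[symmetric])
next
  case (step d)
  note rec = jost_factor_coeff_rec[of a p b, OF pos fin]
  let ?Q = "jost_factor a b p"
  have d: "p = Suc x + d" using step by simp
  obtain C where C: "C > 0" "coeff (?Q (Suc x)) (2 * d) = C * (1 - (a p)\<^sup>2)"
      "a p = 1 \<longrightarrow> coeff (?Q (Suc x)) (2 * d - 1) = - C * b p"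
    using step.IH[of "Suc x"] d by auto
  have deg: "degree (?Q (Suc x)) \<le> 2 * d" "degree (?Q (Suc (Suc x))) \<le> 2 * (d - 1)"
    using degree_jost_factor[of a p b "Suc x", OF pos fin]
      degree_jost_factor[of a p b "Suc (Suc x)", OF pos fin] d by auto
  obtain e where e: "d = Suc e" using step.hyps by (cases d) auto
  have "a x * coeff (?Q x) (2 * Suc d) = C * (1 - (a p)\<^sup>2)"
    using rec(3)[of x "2 * d"] C(2) deg e by (simp add: coeff_eq_0)
  moreover have "a x * coeff (?Q x) (2 * Suc d - 1) = - C * b p" if "a p = 1"
    using rec(3)[of x "2 * d - 1"] C(2,3) deg e that by (simp add: coeff_eq_0)
  ultimately show ?case using pos[of x] C(1)
    by (intro exI[of _ "C / a x"]) (auto simp: field_simps)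
qed

section \<open>Zeros of the Jost function in the disc\<close>

text \<open>Used with two different spectral parameters for the derivative at a zero, and with equal ones for
the constancy of the Wronskian.\<close>

lemma christoffel_darboux:
  fixes u v A B :: "nat \<Rightarrow> 'a :: comm_ring_1"
  assumes "\<And>x. x \<ge> 1 \<Longrightarrow> A x * u (x + 1) + B x * u x + A (x - 1) * u (x - 1) = l * u x"
    and "\<And>x. x \<ge> 1 \<Longrightarrow> A x * v (x + 1) + B x * v x + A (x - 1) * v (x - 1) = m * v x"
  shows "(l - m) * (\<Sum>y=1..x. u y * v y) =
    A x * (u (x + 1) * v x - u x * v (x + 1)) - A 0 * (u 1 * v 0 - u 0 * v 1)"
proof (induction x)
  case (Suc x)
  let ?y = "Suc x"
  have "(l - m) * (\<Sum>y=1..?y. u y * v y) =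
      (l - m) * (\<Sum>y=1..x. u y * v y) + ((l * u ?y) * v ?y - u ?y * (m * v ?y))"
    by (simp add: algebra_simps)
  also have "\<dots> = A x * (u ?y * v x - u x * v ?y) - A 0 * (u 1 * v 0 - u 0 * v 1)
      + ((l * u ?y) * v ?y - u ?y * (m * v ?y))"
    using Suc.IH by simp
  also have "\<dots> = A ?y * (u (?y + 1) * v ?y - u ?y * v (?y + 1)) - A 0 * (u 1 * v 0 - u 0 * v 1)"
    unfolding assms(1)[of ?y, simplified, symmetric] assms(2)[rule_format, of ?y, simplified, symmetric]
    by (simp add: algebra_simps)
  finally show ?case .
qed auto

lemma jost_solution_real:
  fixes z :: real
  assumes "\<And>x. a x > 0" "\<forall>x>p. a x = 1 \<and> b x = 0" "z \<noteq> 0" "x \<ge> 1"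
    and u: "u = (\<lambda>x. z ^ x * poly (jost_factor a b p x) z)"
  shows "a x * u (x + 1) + b x * u x + a (x - 1) * u (x - 1) = (z + inverse z) * u x"
proof -
  have "complex_of_real (a x * u (x + 1) + b x * u x + a (x - 1) * u (x - 1)) =
      of_real ((z + inverse z) * u x)"
    using jost_factor_solves[of a p b "of_real z" "\<lambda>x. of_real (u x)" x, OF assms(1,2) _ _ assms(4)]
      assms(3) by (simp add: u poly_cpoly_of_real of_real_inverse)
  thus ?thesis by (simp only: of_real_eq_iff)
qed

text \<open>Write \<psi>_1(s) = u s 1. The derivative of f at s has the sign opposite to \<psi>_1(s), since up to positive
factors f'(s) \<psi>_1(s) is minus the squared norm of the eigenfunction \<psi>(s); and f(1/s) \<psi>_1(s) = s - 1/s
has the sign opposite to s. The product removes \<psi>_1(s).\<close>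

lemma jost_disc_zero_sign:
  fixes s :: real
  assumes pos: "\<And>x. a x > 0" and fin: "\<forall>x>p. a x = 1 \<and> b x = 0"
    and a0: "a 0 = 1" and s: "s \<noteq> 0" "\<bar>s\<bar> < 1" and f: "f = jost_factor a b p 0"
    and root: "poly f s = 0"
  shows "s * poly (pderiv f) s * poly f (inverse s) > 0"
proof -
  define u where "u z x = z ^ x * poly (jost_factor a b p x) z" for z :: real and x
  have sol: "a x * u z (x + 1) + b x * u z x + a (x - 1) * u z (x - 1) = (z + inverse z) * u z x"
    if "z \<noteq> 0" "x \<ge> 1" for z x
    using jost_solution_real[OF pos fin that refl] by (simp add: u_def)
  have u0: "u z 0 = poly f z" for z by (simp add: u_def f)
  have top: "u z x = z ^ x" if "x > p" for z x using that by (simp add: u_def jost_factor_beyond)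
  \<comment> \<open>The Christoffel-Darboux identity up to p + 1, multiplied by z s and divided by z - s; the power
    of z s is the boundary term, since both solutions are powers beyond p.\<close>
  define G where "G z = (z * s - 1) * (\<Sum>y=1..p+1. u z y * u s y) - (z * s) ^ (p + 2)" for z
  have key: "poly (smult (s * u s 1) ([:0, 1:] * f)) z = (z - s) * G z" if "z \<noteq> 0" for z
  proof -
    have "((z + inverse z) - (s + inverse s)) * (\<Sum>y=1..p+1. u z y * u s y) =
      (z ^ (p + 2) * s ^ (p + 1) - z ^ (p + 1) * s ^ (p + 2)) + poly f z * u s 1"
      using christoffel_darboux[of a "u z" b _ "u s", OF sol[OF that] sol[OF s(1)], of "p + 1"]
        fin[rule_format, of "p + 1"] root by (simp add: u0 top a0)
    hence "poly f z * u s 1 = ((z + inverse z) - (s + inverse s)) * (\<Sum>y=1..p+1. u z y * u s y)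
      - (z ^ (p + 2) * s ^ (p + 1) - z ^ (p + 1) * s ^ (p + 2))" by simp
    from arg_cong[OF this, of "\<lambda>t. z * s * t"] have "z * s * (poly f z * u s 1) =
      (z * s * ((z + inverse z) - (s + inverse s))) * (\<Sum>y=1..p+1. u z y * u s y)
      - z * s * (z ^ (p + 2) * s ^ (p + 1) - z ^ (p + 1) * s ^ (p + 2))"
      by (simp only: right_diff_distrib left_diff_distrib mult.assoc)
    also have "z * s * ((z + inverse z) - (s + inverse s)) = (z - s) * (z * s - 1)"
      using that s(1) by (simp add: field_simps)
    also have "z * s * (z ^ (p + 2) * s ^ (p + 1) - z ^ (p + 1) * s ^ (p + 2))
        = (z - s) * (z * s) ^ (p + 2)"
      by (simp add: power_mult_distrib algebra_simps)
    finally show ?thesis by (simp add: G_def algebra_simps)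
  qed
  have "s * u s 1 * (s * poly (pderiv f) s) = G s"
  proof -
    define F where "F = smult (s * u s 1) ([:0, 1:] * f)"
    have "((\<lambda>z. (poly F z - poly F s) / (z - s)) \<longlongrightarrow> poly (pderiv F) s) (at s)"
      using poly_DERIV[of F s] by (simp add: has_field_derivative_iff)
    moreover have "eventually (\<lambda>z. (poly F z - poly F s) / (z - s) = G z) (at s)"
    proof -
      have "eventually (\<lambda>z. z \<noteq> 0) (at s)"
        using s(1) by (intro eventually_neq_at_within) 
      thus ?thesis using eventually_neq_at_within[of s s UNIV]
        by eventually_elim (use key[of s] s(1) in \<open>auto simp: F_def[symmetric] key[folded F_def]\<close>)
    qed
    ultimately have "(G \<longlongrightarrow> poly (pderiv F) s) (at s)" by (rule Lim_transform_eventually)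
    moreover have "(G \<longlongrightarrow> G s) (at s)"
    proof -
      have "isCont G s" unfolding G_def u_def by (intro continuous_intros)
      thus ?thesis by (simp add: isCont_def)
    qed
    ultimately have "poly (pderiv F) s = G s" by (rule LIM_unique)
    thus ?thesis using root by (simp add: F_def pderiv_smult pderiv_mult pderiv_pCons mult_ac)
  qed
  also have "G s < 0"
  proof -
    have "s * s < 1" using s(2) by (metis abs_square_less_1 power2_eq_square)
    moreover have "(\<Sum>y=1..p+1. u s y * u s y) \<ge> 0" by (intro sum_nonneg) simp
    moreover have "(s * s) ^ (p + 2) > 0" using s(1) by (metis not_square_less_zero
        linorder_neqE_linordered_idom mult_eq_0_iff zero_less_power)
    ultimately have "(s * s - 1) * (\<Sum>y=1..p+1. u s y * u s y) \<le> 0" "(s * s) ^ (p + 2) > 0"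
      by (auto intro: mult_nonpos_nonneg)
    thus ?thesis unfolding G_def by linarith
  qed
  finally have d: "(s * s) * (u s 1 * poly (pderiv f) s) < 0" by (simp add: mult_ac)
  have "s * s > 0" using s(1) by (metis not_square_less_zero
        linorder_neqE_linordered_idom mult_eq_0_iff)
  hence d: "u s 1 * poly (pderiv f) s < 0" using d by (simp add: mult_less_0_iff)
  have "u s 1 * poly f (inverse s) = s - inverse s"
    using christoffel_darboux[of a "u s" b _ "u (inverse s)", OF sol[OF s(1)] sol, of "p + 1"]
      fin[rule_format, of "p + 1"] root s(1) by (simp add: u0 top a0 field_simps)
  hence "s * u s 1 * poly f (inverse s) = s * s - 1" using s(1) by (simp add: field_simps)
  also have "\<dots> < 0" using s(2) by (metis abs_square_less_1 power2_eq_square diff_less_0_iff_less)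
  finally have "(u s 1 * poly (pderiv f) s) * (s * u s 1 * poly f (inverse s)) > 0"
    using d by (simp add: mult_neg_neg)
  hence "(u s 1 * u s 1) * (s * poly (pderiv f) s * poly f (inverse s)) > 0" by (simp add: mult_ac)
  thus ?thesis by (metis not_square_less_zero zero_less_mult_iff)
qed

section \<open>Jost functions of operators of a given type\<close>

text \<open>Whether the Jost function is negative near +\<infinity>, and below whether it is negative near -\<infinity>. These
two bits are all that the case distinction (i)-(iv) contributes: together with f(0) > 0 they fix the
parity of the number of zeros on each half-axis, counted with multiplicity.\<close>

fun flips_pos :: "pert_type \<Rightarrow> bool" where
  "flips_pos A_below = False" | "flips_pos A_above = True"
| "flips_pos B_pos = True" | "flips_pos B_neg = False"

fun flips_neg :: "pert_type \<Rightarrow> bool" where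
  "flips_neg A_below = False" | "flips_neg A_above = True"
| "flips_neg B_pos = False" | "flips_neg B_neg = True"

lemma has_type_parity:
  "p \<ge> 1 \<Longrightarrow> has_type c k p a b \<Longrightarrow> k \<in> {2 * p - 1, 2 * p} \<and> (odd k \<longleftrightarrow> flips_pos c \<noteq> flips_neg c)"
  by (cases c) auto

lemma jost_factor_lead:
  assumes "p \<ge> 1" and J: "jacobi_coeffs a b" and fin: "\<forall>x>p. a x = 1 \<and> b x = 0"
    and k: "k \<in> {2 * p - 1, 2 * p}" and f: "f = jost_factor a b p 0"
  shows "degree f \<le> 2 * p"
    and "k = 2 * p \<Longrightarrow> sgn (coeff f k) = sgn (1 - a p)"
    and "k = 2 * p - 1 \<Longrightarrow> a p = 1 \<Longrightarrow> sgn (coeff f k) = - sgn (b p)"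
    and "coeff f (2 * p) = 0 \<longleftrightarrow> a p = 1"
proof -
  note pos = jacobi_coeffs_pos[OF J]
  show "degree f \<le> 2 * p" using degree_jost_factor[of a p b 0, OF pos fin] f by simp
  obtain C where C: "C > 0" "coeff f (2 * p) = C * (1 - (a p)\<^sup>2)"
     "a p = 1 \<longrightarrow> coeff f (2 * p - 1) = - C * b p"
    using jost_factor_top_coeffs[of a p b 0 p, OF pos fin] \<open>p \<ge> 1\<close> f by auto
  have fac: "C * (1 - (a p)\<^sup>2) = (C * (1 + a p)) * (1 - a p)"
    by (simp add: power2_eq_square algebra_simps)
  have Cp: "C * (1 + a p) > 0" using C(1) pos[of p] by simp
  show "sgn (coeff f k) = sgn (1 - a p)" if "k = 2 * p"
  proof -
    have "sgn (C * (1 + a p)) = 1" using Cp by simp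
    thus ?thesis using that by (metis C(2) fac mult_1 sgn_mult)
  qed
  show "k = 2 * p - 1 \<Longrightarrow> a p = 1 \<Longrightarrow> sgn (coeff f k) = - sgn (b p)"
    using C(1,3) by (simp add: sgn_mult)
  show "coeff f (2 * p) = 0 \<longleftrightarrow> a p = 1"
    using Cp unfolding C(2) fac by auto
qed

lemma perturbation_top:
  assumes "p \<ge> 1"
  shows "perturbation a b (2 * p) = a p - 1" "perturbation a b (2 * p - 1) = b p"
  using assms by (auto simp: perturbation_def)

text \<open>Everything about the operator that the upper bounds use.\<close>

lemma jost_polynomial_of_class:
  assumes "p \<ge> 1" and cl: "jacobi_class c k p np nm a b"
  obtains f where "jost_function a b p = cpoly f" "degree f = k" "poly f 0 > 0"
    "if flips_pos c then lead_coeff f < 0 else lead_coeff f > 0"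
    "\<And>s. s \<noteq> 0 \<Longrightarrow> \<bar>s\<bar> < 1 \<Longrightarrow> poly f s = 0 \<Longrightarrow> s * poly (pderiv f) s * poly f (inverse s) > 0"
    "np = card {s. 0 < s \<and> s < 1 \<and> poly f s = 0}"
    "nm = card {s. -1 < s \<and> s < 0 \<and> poly f s = 0}"
proof -
  have J: "jacobi_coeffs a b" and q: "perturbation a b \<in> pert_space k" and t: "has_type c k p a b"
    using cl by (auto simp: jacobi_class_def)
  note k = conjunct1[OF has_type_parity[OF \<open>p \<ge> 1\<close> t]]
  have fin: "\<forall>x>p. a x = 1 \<and> b x = 0" using pert_space_tail[OF q k] by blast
  note pos = jacobi_coeffs_pos[OF J]
  define f where "f = jost_factor a b p 0"
  note lead = jost_factor_lead[OF \<open>p \<ge> 1\<close> J fin k f_def]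
  have F: "jost_function a b p = cpoly f" unfolding f_def by (rule jost_function_eq_cpoly[OF J q k])
  have nz: "perturbation a b k \<noteq> 0" and z: "\<And>x. x > k \<Longrightarrow> perturbation a b x = 0"
    using q by (auto simp: pert_space_def)
  have ap: "a p = 1" if "k = 2 * p - 1"
    using z[of "2 * p"] perturbation_top[OF \<open>p \<ge> 1\<close>, of a b] that \<open>p \<ge> 1\<close> by simp
  have sg: "if flips_pos c then coeff f k < 0 else coeff f k > 0"
  proof (cases c)
    case A_below
    hence "sgn (coeff f k) = 1" using lead(2) t by simp
    thus ?thesis using A_below by (simp add: sgn_1_pos)
  next
    case A_above
    hence "sgn (coeff f k) = -1" using lead(2) t by simp
    thus ?thesis using A_above by (simp add: sgn_1_neg)
  next
    case B_pos
    hence "sgn (coeff f k) = -1" using lead(3) t ap by simp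
    thus ?thesis using B_pos by (simp add: sgn_1_neg)
  next
    case B_neg
    hence "sgn (coeff f k) = 1" using lead(3) t ap by simp
    thus ?thesis using B_neg by (simp add: sgn_1_pos)
  qed
  have deg: "degree f = k"
  proof (rule antisym)
    show "k \<le> degree f" using sg by (intro le_degree) (auto split: if_splits)
    show "degree f \<le> k"
    proof (cases "k = 2 * p")
      case False
      hence "k = 2 * p - 1" using k by auto
      hence "coeff f (2 * p) = 0" using lead(4) ap by blast
      hence "degree f \<noteq> 2 * p" using \<open>p \<ge> 1\<close> by (metis degree_0 leading_coeff_0_iff mult_eq_0_iff
         not_one_le_zero zero_neq_numeral)
      thus ?thesis using lead(1) \<open>k = 2 * p - 1\<close> by linarith
    qed (use lead(1) in simp)
  qed
  have droots: "of_real s \<in> disc_roots a b p \<longleftrightarrow> \<bar>s\<bar> < 1 \<and> poly f s = 0" for s :: real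
    by (simp add: disc_roots_def F poly_cpoly_of_real)
  show thesis
  proof (rule that[OF F deg])
    show "poly f 0 > 0" using jost_factor_const_pos[of a p b 0, OF pos fin]
      by (simp add: poly_0_coeff_0 f_def)
    show "if flips_pos c then lead_coeff f < 0 else lead_coeff f > 0" using sg deg by simp
    show "s * poly (pderiv f) s * poly f (inverse s) > 0"
      if "s \<noteq> 0" "\<bar>s\<bar> < 1" "poly f s = 0" for s
      using J by (intro jost_disc_zero_sign[of a p b s f, OF pos fin _ that(1,2) f_def that(3)])
        (simp add: jacobi_coeffs_def)
    have "np = card {s::real. s > 0 \<and> of_real s \<in> disc_roots a b p}"
      "nm = card {s::real. s < 0 \<and> of_real s \<in> disc_roots a b p}"
      using cl by (auto simp: jacobi_class_def)
    moreover have "{s::real. s > 0 \<and> of_real s \<in> disc_roots a b p} = {s. 0 < s \<and> s < 1 \<and> poly f s = 0}"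
      "{s::real. s < 0 \<and> of_real s \<in> disc_roots a b p} = {s. -1 < s \<and> s < 0 \<and> poly f s = 0}"
      by (auto simp: droots)
    ultimately show "np = card {s. 0 < s \<and> s < 1 \<and> poly f s = 0}"
      "nm = card {s. -1 < s \<and> s < 0 \<and> poly f s = 0}" by simp_all
  qed
qed

section \<open>Counting real zeros\<close>

text \<open>The least number of distinct positive zeros of a Jost function that has n of them in the disc:
the n zeros, n - 1 zeros between their reciprocals and, if n \<ge> 1 and there is no sign change between
0 and infinity, one zero beyond the largest reciprocal. A sign change between 0 and infinity
forces one zero also when n = 0.\<close>

definition forced_zeros :: "nat \<Rightarrow> bool \<Rightarrow> nat" where
  "forced_zeros n \<tau> = (if \<tau> then 2 * max n 1 - 1 else 2 * n)"

definition forced_total :: "pert_type \<Rightarrow> nat \<Rightarrow> nat \<Rightarrow> nat" where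
  "forced_total c np nm = forced_zeros np (flips_pos c) + forced_zeros nm (flips_neg c)"

lemma deriv_nonpos_at_right_end:
  fixes f :: "real poly"
  assumes "l < s" "\<And>x. l < x \<Longrightarrow> x < s \<Longrightarrow> poly f x > 0" "poly f s = 0"
  shows "poly (pderiv f) s \<le> 0"
proof (rule ccontr)
  assume "\<not> poly (pderiv f) s \<le> 0"
  then obtain d where d: "d > 0" "\<forall>h>0. h < d \<longrightarrow> poly f (s - h) < poly f s"
    using DERIV_pos_inc_left[OF poly_DERIV[of f s]] by auto
  define h where "h = min (d / 2) ((s - l) / 2)"
  have "h > 0" "h < d" "s - h > l" using d(1) assms(1) by (auto simp: h_def min_def field_simps)
  thus False using d(2) assms(2)[of "s - h"] assms(3) by fastforce
qed

lemma deriv_nonneg_at_left_end: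
  fixes f :: "real poly"
  assumes "s < u" "\<And>x. s < x \<Longrightarrow> x < u \<Longrightarrow> poly f x > 0" "poly f s = 0"
  shows "poly (pderiv f) s \<ge> 0"
proof (rule ccontr)
  assume "\<not> poly (pderiv f) s \<ge> 0"
  then obtain d where d: "d > 0" "\<forall>h>0. h < d \<longrightarrow> poly f (s + h) < poly f s"
    using DERIV_neg_dec_right[OF poly_DERIV[of f s]] by auto
  define h where "h = min (d / 2) ((u - s) / 2)"
  have "h > 0" "h < d" "s + h < u" using d(1) assms(1) by (auto simp: h_def min_def field_simps)
  thus False using d(2) assms(2)[of "s + h"] assms(3) by fastforce
qed

lemma poly_constant_sign:
  fixes f :: "real poly"
  assumes "\<And>x. l < x \<Longrightarrow> x < u \<Longrightarrow> poly f x \<noteq> 0"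
  shows "(\<forall>x. l < x \<and> x < u \<longrightarrow> poly f x > 0) \<or> (\<forall>x. l < x \<and> x < u \<longrightarrow> poly f x < 0)"
proof (rule ccontr)
  assume "\<not> ?thesis"
  then obtain x y where xy: "l < x" "x < u" "l < y" "y < u" "poly f x \<le> 0" "poly f y \<ge> 0"
    by (auto simp: not_less)
  hence sg: "poly f x < 0" "poly f y > 0" using assms by force+
  have "\<exists>z. min x y < z \<and> z < max x y \<and> poly f z = 0"
  proof (cases "x < y")
    case True
    thus ?thesis using poly_IVT_pos[OF True sg] by auto
  next
    case False
    hence "y < x" using sg by (metis linorder_neqE_linordered_idom order_less_asym)
    thus ?thesis using poly_IVT_neg[OF \<open>y < x\<close> sg(2,1)] by auto
  qed
  thus False using assms xy by (metis less_max_iff_disj min_less_iff_disj order_less_trans)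
qed

lemma consecutive_roots_deriv:
  fixes f :: "real poly"
  assumes "t < s" "poly f t = 0" "poly f s = 0" "\<And>x. t < x \<Longrightarrow> x < s \<Longrightarrow> poly f x \<noteq> 0"
  shows "poly (pderiv f) t * poly (pderiv f) s \<le> 0"
proof -
  consider "\<forall>x. t < x \<and> x < s \<longrightarrow> poly f x > 0" | "\<forall>x. t < x \<and> x < s \<longrightarrow> poly f x < 0"
    using poly_constant_sign[of t s f] assms(4) by blast
  thus ?thesis
  proof cases
    case 1
    thus ?thesis using deriv_nonneg_at_left_end[of t s f] deriv_nonpos_at_right_end[of t s f] assms
      by (simp add: mult_nonneg_nonpos)
  next
    case 2
    thus ?thesis
      using deriv_nonneg_at_left_end[of t s "- f"] deriv_nonpos_at_right_end[of t s "- f"] assms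
      by (simp add: mult_nonpos_nonneg pderiv_minus)
  qed
qed

lemma poly_root_beyond:
  fixes f :: "real poly"
  assumes "poly f x * lead_coeff f < 0"
  shows "\<exists>y>x. poly f y = 0"
proof -
  have pos: "\<exists>y>x. poly g y = 0" if gx: "poly g x < 0" and lg: "lead_coeff g > 0" for g :: "real poly"
  proof -
    obtain n where n: "\<forall>y\<ge>n. poly g y \<ge> lead_coeff g" using poly_pinfty_gt_lc[OF lg] by blast
    hence "poly g (max n (x + 1)) > 0" using lg by (meson less_le_trans max.cobounded1)
    moreover have "x < max n (x + 1)" by simp
    ultimately show ?thesis using poly_IVT_pos[of x "max n (x + 1)" g] gx by blast
  qed
  show ?thesis
  proof (cases "poly f x < 0")
    case True
    thus ?thesis using pos[of f] assms by (simp add: mult_less_0_iff)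
  next
    case False
    thus ?thesis using pos[of "- f"] assms by (simp add: mult_less_0_iff)
  qed
qed

text \<open>To every zero s in (0,1) other than the smallest one belongs a zero between 1/s and the reciprocal
of the preceding zero; these intervals are disjoint. The smallest zero m satisfies f(1/m) < 0, so
without a sign change at infinity there is a zero beyond 1/m, which is then assigned to m.\<close>

lemma card_positive_roots_ge:
  fixes f :: "real poly"
  assumes f0: "poly f 0 > 0"
    and lead: "if \<tau> then lead_coeff f < 0 else lead_coeff f > 0"
    and S_def: "S = {s. 0 < s \<and> s < 1 \<and> poly f s = 0}"
    and sign: "\<And>s. s \<in> S \<Longrightarrow> poly (pderiv f) s * poly f (inverse s) > 0"
  shows "card {x. x > 0 \<and> poly f x = 0} \<ge> forced_zeros (card S) \<tau>"
proof -
  let ?R = "{x. x > 0 \<and> poly f x = 0}"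
  have fin: "finite ?R" using f0 by (intro finite_subset[OF _ poly_roots_finite[of f]]) auto
  have finS: "finite S" by (rule finite_subset[OF _ fin]) (auto simp: S_def)
  show ?thesis
  proof (cases "S = {}")
    case True
    show ?thesis
    proof (cases \<tau>)
      case True
      hence "poly f 0 * lead_coeff f < 0" using f0 lead by (simp add: mult_pos_neg)
      then obtain y where "y \<in> ?R" using poly_root_beyond by blast
      hence "card ?R > 0" using fin by (auto simp: card_gt_0_iff)
      thus ?thesis using True \<open>S = {}\<close> by (simp add: forced_zeros_def)
    qed (use True in \<open>simp add: forced_zeros_def\<close>)
  next
    case False
    define m where "m = Min S"
    have m: "m \<in> S" "\<And>s. s \<in> S \<Longrightarrow> m \<le> s" using finS False by (auto simp: m_def)
    have neg: "poly f (inverse m) < 0"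
    proof -
      have "poly f x > 0" if x: "0 < x" "x < m" for x
      proof (rule ccontr)
        assume "\<not> poly f x > 0"
        hence "poly f x < 0" using x m by (force simp: S_def not_less)
        then obtain y where "0 < y" "y < x" "poly f y = 0" using poly_IVT_neg[OF x(1) f0] by blast
        thus False using x m by (force simp: S_def)
      qed
      hence "poly (pderiv f) m \<le> 0" using m(1)
        by (intro deriv_nonpos_at_right_end[of 0]) (auto simp: S_def)
      thus ?thesis using sign[OF m(1)] by (auto simp: zero_less_mult_iff)
    qed
    define T where "T = (if \<tau> then S - {m} else S)"
    have "\<exists>\<rho>. inverse s < \<rho> \<and> poly f \<rho> = 0 \<and> (\<forall>t\<in>S. t < s \<longrightarrow> \<rho> < inverse t)" if s: "s \<in> T" for s
    proof (cases "s = m")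
      case True
      hence "lead_coeff f > 0" using s lead by (auto simp: T_def split: if_splits)
      hence "\<exists>y>inverse m. poly f y = 0" using neg by (intro poly_root_beyond mult_neg_pos)
      thus ?thesis using True m(2) by force
    next
      case False
      define t where "t = Max {t\<in>S. t < s}"
      have sS: "s \<in> S" using s by (auto simp: T_def split: if_splits)
      have "m \<in> {t\<in>S. t < s}" using m False sS by force
      hence "t \<in> {t\<in>S. t < s}" unfolding t_def using finS by (intro Max_in) auto
      hence t: "t \<in> S" "t < s" by auto
      have tmax: "t' \<le> t" if "t' \<in> S" "t' < s" for t'
        unfolding t_def using that finS by (intro Max_ge) auto
      have "poly (pderiv f) t * poly (pderiv f) s \<le> 0"
      proof (rule consecutive_roots_deriv[OF t(2)])
        fix x assume x: "t < x" "x < s"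
        show "poly f x \<noteq> 0"
        proof
          assume "poly f x = 0"
          hence "x \<in> S" using x t(1) sS by (auto simp: S_def)
          thus False using tmax[of x] x by simp
        qed
      qed (use t sS in \<open>auto simp: S_def\<close>)
      moreover have "(poly (pderiv f) t * poly (pderiv f) s) *
          (poly f (inverse t) * poly f (inverse s)) > 0"
        using mult_pos_pos[OF sign[OF t(1)] sign[OF sS]] by (simp add: mult_ac)
      moreover have aux: "Y < 0" if "X \<le> 0" "X * Y > 0" for X Y :: real
        using that by (auto simp: zero_less_mult_iff)
      ultimately have "poly f (inverse s) * poly f (inverse t) < 0"
        using aux by (simp add: mult.commute)
      moreover have "inverse s < inverse t" using t by (auto simp: S_def)
      ultimately obtain \<rho> where "inverse s < \<rho>" "\<rho> < inverse t" "poly f \<rho> = 0"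
        using poly_IVT by blast
      moreover have "inverse t \<le> inverse t'" if "t' \<in> S" "t' < s" for t'
        using tmax[OF that] that by (auto simp: S_def)
      ultimately show ?thesis by (meson less_le_trans)
    qed
    then obtain \<rho> where \<rho>: "\<And>s. s \<in> T \<Longrightarrow> inverse s < \<rho> s" "\<And>s. s \<in> T \<Longrightarrow> poly f (\<rho> s) = 0"
      "\<And>s t. s \<in> T \<Longrightarrow> t \<in> S \<Longrightarrow> t < s \<Longrightarrow> \<rho> s < inverse t" by metis
    have TS: "T \<subseteq> S" by (auto simp: T_def)
    have inj: "inj_on \<rho> T"
    proof (rule linorder_inj_onI)
      fix s t assume "s < t" "s \<in> T" "t \<in> T"
      thus "\<rho> s \<noteq> \<rho> t" using \<rho>(1)[of s] \<rho>(3)[of t s] TS by force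
    qed auto
    have big: "\<rho> s > 1" if "s \<in> T" for s
      using \<rho>(1)[OF that] that TS by (auto simp: S_def intro: less_trans dest: one_less_inverse)
    have "card (S \<union> \<rho> ` T) \<le> card ?R"
      using big \<rho>(2) by (intro card_mono fin) (force simp: S_def)
    also have "card (S \<union> \<rho> ` T) = card S + card T"
    proof -
      have "S \<inter> \<rho> ` T = {}" using big by (force simp: S_def)
      thus ?thesis using finS TS inj
        by (subst card_Un_disjoint) (auto simp: card_image intro: finite_subset)
    qed
    also have "card S + card T = forced_zeros (card S) \<tau>"
    proof -
      have "card S > 0" using finS False by (simp add: card_gt_0_iff)
      thus ?thesis using m(1) finS by (auto simp: T_def forced_zeros_def)
    qed
    finally show ?thesis .
  qed
qed

lemma card_real_roots_ge:
  fixes f :: "real poly"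
  assumes f0: "poly f 0 > 0" and par: "odd (degree f) \<longleftrightarrow> \<tau> \<noteq> \<tau>'"
    and lead: "if \<tau> then lead_coeff f < 0 else lead_coeff f > 0"
    and sign: "\<And>s. s \<noteq> 0 \<Longrightarrow> \<bar>s\<bar> < 1 \<Longrightarrow> poly f s = 0 \<Longrightarrow> s * poly (pderiv f) s * poly f (inverse s) > 0"
    and np: "np = card {s. 0 < s \<and> s < 1 \<and> poly f s = 0}"
    and nm: "nm = card {s. -1 < s \<and> s < 0 \<and> poly f s = 0}"
  shows "card {x. poly f x = 0} \<ge> forced_zeros np \<tau> + forced_zeros nm \<tau>'"
proof -
  have fin: "finite {x. poly f x = 0}" using f0 by (intro poly_roots_finite) auto
  have 1: "card {x. x > 0 \<and> poly f x = 0} \<ge> forced_zeros np \<tau>"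
    unfolding np
  proof (rule card_positive_roots_ge[OF f0 lead refl])
    fix s assume "s \<in> {s. 0 < s \<and> s < 1 \<and> poly f s = 0}"
    hence "s > 0" "s * (poly (pderiv f) s * poly f (inverse s)) > 0" using sign[of s] by auto
    thus "poly (pderiv f) s * poly f (inverse s) > 0" by (rule zero_less_mult_pos[rotated])
  qed
  define g where "g = pcompose f [:0, -1:]"
  have g: "poly g x = poly f (- x)" for x by (simp add: g_def poly_pcompose)
  have g': "poly (pderiv g) x = - poly (pderiv f) (- x)" for x
    by (simp add: g_def pderiv_pcompose poly_pcompose pderiv_pCons)
  have mirror: "card {x. P x} = card {x::real. P (- x)}" for P
  proof -
    have "{x. P x} = uminus ` {x::real. P (- x)}" by (auto simp: image_iff) (metis minus_minus)
    thus ?thesis by (simp add: card_image)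
  qed
  have lg: "lead_coeff g = lead_coeff f * (-1) ^ degree f" by (simp add: g_def lead_coeff_comp)
  have "card {x. x > 0 \<and> poly g x = 0} \<ge> forced_zeros nm \<tau>'"
  proof -
    have nm': "nm = card {s. 0 < s \<and> s < 1 \<and> poly g s = 0}"
      unfolding nm by (subst mirror) (auto simp: g intro!: arg_cong[of _ _ card])
    show ?thesis unfolding nm'
    proof (rule card_positive_roots_ge[OF _ _ refl])
      show "poly g 0 > 0" using f0 by (simp add: g)
      show "if \<tau>' then lead_coeff g < 0 else lead_coeff g > 0"
        using lead par unfolding lg by (cases \<tau>; cases \<tau>') auto
      fix s assume "s \<in> {s. 0 < s \<and> s < 1 \<and> poly g s = 0}"
      hence "s > 0" "s * (poly (pderiv g) s * poly g (inverse s)) > 0"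
        using sign[of "- s"] by (auto simp: g g' mult_ac)
      thus "poly (pderiv g) s * poly g (inverse s) > 0" by (rule zero_less_mult_pos[rotated])
    qed
  qed
  also have "card {x. x > 0 \<and> poly g x = 0} = card {x. x < 0 \<and> poly f x = 0}"
    by (subst mirror) (simp add: g)
  finally have 2: "card {x. x < 0 \<and> poly f x = 0} \<ge> forced_zeros nm \<tau>'" .
  have "card {x. x > 0 \<and> poly f x = 0} + card {x. x < 0 \<and> poly f x = 0}
      = card ({x. x > 0 \<and> poly f x = 0} \<union> {x. x < 0 \<and> poly f x = 0})"
    using fin by (intro card_Un_disjoint[symmetric]) (auto intro: finite_subset)
  also have "\<dots> \<le> card {x. poly f x = 0}" by (intro card_mono fin) auto
  finally show ?thesis using 1 2 by simp
qed

section \<open>Upper bounds for the multiplicities\<close>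

lemma sum_order_le:
  fixes F :: "complex poly"
  assumes "F \<noteq> 0" "finite A"
  shows "(\<Sum>z\<in>A. order z F) \<le> degree F"
proof -
  have "(\<Sum>z\<in>A. order z F) = (\<Sum>z\<in>{z\<in>A. poly F z = 0}. order z F)"
    using assms by (intro sum.mono_neutral_right) (auto simp: order_root)
  also have "\<dots> \<le> (\<Sum>z | poly F z = 0. order z F)"
    using assms by (intro sum_mono2 poly_roots_finite) auto
  also have "\<dots> \<le> degree F" by (rule sum_order_le_degree[OF assms(1)])
  finally show ?thesis .
qed

lemma card_le_sum_order:
  fixes F :: "complex poly"
  assumes "F \<noteq> 0" "finite A" "\<And>z. z \<in> A \<Longrightarrow> poly F z = 0"
  shows "card A \<le> (\<Sum>z\<in>A. order z F)"
proof -
  have "(\<Sum>z\<in>A. 1) \<le> (\<Sum>z\<in>A. order z F)"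
    using assms by (intro sum_mono) (metis One_nat_def Suc_leI neq0_conv order_root)
  thus ?thesis by simp
qed

lemma order_cnj: "f \<noteq> 0 \<Longrightarrow> order (cnj z) (cpoly f) = order z (cpoly f)"
proof -
  assume "f \<noteq> 0"
  have le: "order w (cpoly f) \<le> order (cnj w) (cpoly f)" for w
  proof -
    obtain q where q: "cpoly f = [:- w, 1:] ^ order w (cpoly f) * q" using order_1 by (metis dvdE)
    have cnj_mult: "map_poly cnj (g * h) = map_poly cnj g * map_poly cnj h" for g h
      by (rule poly_eqI) (simp add: coeff_map_poly coeff_mult)
    have cnj_power: "map_poly cnj (g ^ n) = map_poly cnj g ^ n" for g n
      by (induction n) (auto simp: cnj_mult)
    have "cpoly f = map_poly cnj (cpoly f)" by (rule poly_eqI) (simp add: coeff_map_poly)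
    also have "\<dots> = [:- cnj w, 1:] ^ order w (cpoly f) * map_poly cnj q"
      by (subst q) (simp add: cnj_mult cnj_power map_poly_pCons)
    finally have "[:- cnj w, 1:] ^ order w (cpoly f) dvd cpoly f" by (rule dvdI)
    thus ?thesis using order_divides[of "cnj w" "order w (cpoly f)" "cpoly f"] \<open>f \<noteq> 0\<close>
      by (auto simp: cpoly_eq_0_iff)
  qed
  show ?thesis using le[of z] le[of "cnj z"] by (simp add: antisym)
qed

text \<open>All bounds compare the degree k with the sum of the orders over a finite set: the forced real zeros
together with r and, if r is not real, its conjugate; or the zeros in the disc together with r.\<close>

lemma multiplicity_bounds:
  assumes "p \<ge> 1" and cl: "jacobi_class c k p np nm a b" and r: "r \<in> resonances a b p"
  defines "m \<equiv> order r (jost_function a b p)"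
    and "z \<equiv> forced_total c np nm"
  shows "z \<le> k" "m \<ge> 1" "r \<notin> \<real> \<Longrightarrow> 2 * m + z \<le> k"
    "r \<in> \<real> \<Longrightarrow> m + z \<le> k + 1" "m + (np + nm) \<le> k"
proof -
  obtain f where f: "jost_function a b p = cpoly f" "degree f = k" "poly f 0 > 0"
    "if flips_pos c then lead_coeff f < 0 else lead_coeff f > 0"
    "\<And>s. s \<noteq> 0 \<Longrightarrow> \<bar>s\<bar> < 1 \<Longrightarrow> poly f s = 0 \<Longrightarrow> s * poly (pderiv f) s * poly f (inverse s) > 0"
    "np = card {s. 0 < s \<and> s < 1 \<and> poly f s = 0}"
    "nm = card {s. -1 < s \<and> s < 0 \<and> poly f s = 0}"
    by (rule jost_polynomial_of_class[OF assms(1) cl]) blast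
  have t: "has_type c k p a b" using cl by (simp add: jacobi_class_def)
  have f_nz: "f \<noteq> 0" "cpoly f \<noteq> 0" using f(3) by (auto simp: cpoly_eq_0_iff)
  define Z where "Z = (of_real :: real \<Rightarrow> complex) ` {x. poly f x = 0}"
  have fin: "finite {x. poly f x = 0}" by (rule poly_roots_finite[OF f_nz(1)])
  have Z: "finite Z" "\<And>x. x \<in> Z \<Longrightarrow> poly (cpoly f) x = 0" "Z \<subseteq> \<real>"
    using fin by (auto simp: Z_def poly_cpoly_of_real)
  have "card {x. poly f x = 0} \<ge> z" unfolding z_def forced_total_def
    using card_real_roots_ge[OF f(3) _ f(4,5,6,7)] conjunct2[OF has_type_parity[OF assms(1) t]] f(2)
    by blast
  hence cZ: "card Z \<ge> z" by (simp add: Z_def card_image inj_on_def)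
  note ub = sum_order_le[OF f_nz(2), unfolded degree_cpoly f(2)]
  note lb = card_le_sum_order[OF f_nz(2)]
  show "z \<le> k" using cZ ub[OF Z(1)] lb[OF Z(1,2)] by simp
  have root: "poly (cpoly f) r = 0" "norm r \<ge> 1" using r by (auto simp: resonances_def f(1))
  show m1: "m \<ge> 1" using root(1) f_nz by (auto simp: m_def f(1) order_root Suc_le_eq)
  show "2 * m + z \<le> k" if "r \<notin> \<real>"
  proof -
    have ne: "r \<noteq> cnj r" "r \<notin> Z" "cnj r \<notin> Z" using that Z(3)
      by (auto simp: Reals_cnj_iff)
    hence "(\<Sum>x\<in>insert r (insert (cnj r) Z). order x (cpoly f)) = 2 * m + (\<Sum>x\<in>Z. order x (cpoly f))"
      using Z(1) by (simp add: order_cnj f_nz(1) m_def f(1))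
    thus ?thesis using ub[of "insert r (insert (cnj r) Z)"] lb[OF Z(1,2)] cZ Z(1) by simp
  qed
  have gen: "m + card (A - {r}) \<le> k" if "finite A" "\<And>x. x \<in> A \<Longrightarrow> poly (cpoly f) x = 0" for A
  proof -
    have "(\<Sum>x\<in>insert r (A - {r}). order x (cpoly f)) = m + (\<Sum>x\<in>A - {r}. order x (cpoly f))"
      using that(1) by (subst sum.insert) (auto simp: m_def f(1))
    thus ?thesis using ub[of "insert r (A - {r})"] lb[of "A - {r}"] that by simp
  qed
  show "m + z \<le> k + 1" using gen[OF Z(1,2)] cZ by (simp add: card_Diff_singleton_if split: if_splits)
  define A where "A = (of_real :: real \<Rightarrow> complex) `
    ({s. 0 < s \<and> s < 1 \<and> poly f s = 0} \<union> {s. -1 < s \<and> s < 0 \<and> poly f s = 0})"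
  have "card A = np + nm"
  proof -
    have "card A = card ({s. 0 < s \<and> s < 1 \<and> poly f s = 0} \<union> {s. -1 < s \<and> s < 0 \<and> poly f s = 0})"
      unfolding A_def by (intro card_image) (auto simp: inj_on_def)
    also have "\<dots> = np + nm" unfolding f(6,7)
      by (intro card_Un_disjoint) (auto intro: finite_subset[OF _ fin])
    finally show ?thesis .
  qed
  moreover have "r \<notin> A" using root(2) by (auto simp: A_def)
  moreover have "finite A" "\<And>x. x \<in> A \<Longrightarrow> poly (cpoly f) x = 0"
    by (auto simp: A_def poly_cpoly_of_real intro: finite_subset[OF _ fin])
  ultimately show "m + (np + nm) \<le> k" using gen[of A] by simp
qed

section \<open>A circle integral with simple poles\<close>

text \<open>The residue theorem on a disc slightly larger than the unit disc that contains no further zero of F.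
The residues are computed as limits, so that H may vanish at a zero of F.\<close>

lemma circle_integral_simple_poles:
  fixes F H :: "complex poly"
  assumes zeros: "\<And>z. norm z \<le> 1 \<Longrightarrow> poly F z = 0 \<longleftrightarrow> z \<in> S" and S: "S \<subseteq> ball 0 1"
    and simple: "\<And>s. s \<in> S \<Longrightarrow> poly (pderiv F) s \<noteq> 0"
  shows "((\<lambda>t. poly H (cis t) / poly F (cis t) * \<i> * cis t) has_integral
    2 * pi * \<i> * (\<Sum>s\<in>S. poly H s / poly (pderiv F) s)) {0..2*pi}"
proof -
  have "poly F 1 \<noteq> 0" using zeros[of 1] S by auto
  hence F: "F \<noteq> 0" by auto
  have fin: "finite {z. poly F z = 0}" by (rule poly_roots_finite[OF F])
  have finS: "finite S" using zeros S by (intro finite_subset[OF _ fin]) (auto simp: subset_iff)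
  \<comment> \<open>the value 2 only serves to make the set nonempty\<close>
  define R where "R = Min (insert 2 (norm ` {z. poly F z = 0 \<and> norm z > 1}))"
  have finN: "finite (norm ` {z. poly F z = 0 \<and> norm z > 1})"
    by (intro finite_imageI finite_subset[OF _ fin]) auto
  have R1: "R > 1" unfolding R_def using finN by (subst Min_gr_iff) auto
  have R: "poly F z \<noteq> 0" if "norm z < R" "z \<notin> S" for z
  proof
    assume z: "poly F z = 0"
    hence "norm z > 1" using zeros[of z] that by (meson not_le)
    hence "R \<le> norm z" unfolding R_def using finN z by (intro Min_le) auto
    thus False using that by simp
  qed
  define h where "h = (\<lambda>z. poly H z / poly F z)"
  have sub: "sphere 0 1 \<subseteq> ball 0 R - S" using R1 S by auto
  have holo: "h holomorphic_on ball 0 R - S"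
    unfolding h_def using R by (intro holomorphic_intros) auto
  have "contour_integral (circlepath 0 1) h =
    2 * pi * \<i> * (\<Sum>s\<in>S. winding_number (circlepath 0 1) s * residue h s)"
  proof (rule Residue_theorem[OF _ _ finS holo])
    show "\<forall>z. z \<notin> ball 0 R \<longrightarrow> winding_number (circlepath 0 1) z = 0"
    proof (intro allI impI)
      fix z :: complex assume "z \<notin> ball 0 R"
      thus "winding_number (circlepath 0 1) z = 0"
        using sub by (intro winding_number_zero_outside[of _ "ball 0 R"]) auto
    qed
  qed (use sub in auto)
  also have "(\<Sum>s\<in>S. winding_number (circlepath 0 1) s * residue h s) =
    (\<Sum>s\<in>S. poly H s / poly (pderiv F) s)"
  proof (rule sum.cong[OF refl])
    fix s assume s: "s \<in> S"
    have "winding_number (circlepath 0 1) s = 1"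
      using s S by (intro winding_number_circlepath) auto
    moreover have "residue h s = poly H s / poly (pderiv F) s"
    proof (rule residue_simple')
      show "open (ball 0 R - (S - {s}))" using finS by (intro open_Diff finite_imp_closed) auto
      show "s \<in> ball 0 R - (S - {s})" using s S R1 by force
      show "h holomorphic_on ball 0 R - (S - {s}) - {s}"
        by (rule holomorphic_on_subset[OF holo]) auto
      have s0: "poly F s = 0" using zeros[of s] s S by force
      have "((\<lambda>w. (poly F w - poly F s) / (w - s)) \<longlongrightarrow> poly (pderiv F) s) (at s)"
        using poly_DERIV[of F s] by (simp add: has_field_derivative_iff)
      hence "((\<lambda>w. poly H w / ((poly F w - poly F s) / (w - s))) \<longlongrightarrow> poly H s / poly (pderiv F) s) (at s)"
        using simple[OF s] by (intro tendsto_divide) (auto intro!: tendsto_intros)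
      thus "((\<lambda>w. h w * (w - s)) \<longlongrightarrow> poly H s / poly (pderiv F) s) (at s)"
        by (simp add: h_def s0)
    qed
    ultimately show "winding_number (circlepath 0 1) s * residue h s = poly H s / poly (pderiv F) s"
      by simp
  qed
  finally have ci: "contour_integral (circlepath 0 1) h =
    2 * pi * \<i> * (\<Sum>s\<in>S. poly H s / poly (pderiv F) s)" .
  have "h contour_integrable_on circlepath 0 1"
    using sub by (intro contour_integrable_continuous_circlepath holomorphic_on_imp_continuous_on
      holomorphic_on_subset[OF holo]) auto
  hence "(h has_contour_integral (2 * pi * \<i> * (\<Sum>s\<in>S. poly H s / poly (pderiv F) s))) (circlepath 0 1)"
    using has_contour_integral_integral ci by metis
  thus ?thesis unfolding circlepath_def h_def
    by (subst (asm) has_contour_integral_part_circlepath_iff) auto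
qed

section \<open>Polynomials of Bernstein-Szego type\<close>

text \<open>Chebyshev polynomials of the second kind in the variable \<lambda> = z + 1/z = 2 cos t, with the index
shifted so that their degree is n - 1.\<close>

fun cheb_u :: "nat \<Rightarrow> real poly" where
  "cheb_u 0 = 0"
| "cheb_u (Suc 0) = 1"
| "cheb_u (Suc (Suc n)) = [:0, 1:] * cheb_u (Suc n) - cheb_u n"

lemma cheb_u_eval:
  assumes "z \<noteq> 0"
  shows "(inverse z - z) * poly (cpoly (cheb_u n)) (z + inverse z) = inverse z ^ n - z ^ n"
proof (induction n rule: cheb_u.induct)
  case (3 n)
  let ?U = "\<lambda>n. poly (cpoly (cheb_u n)) (z + inverse z)"
  have "(inverse z - z) * ?U (Suc (Suc n)) =
      (z + inverse z) * ((inverse z - z) * ?U (Suc n)) - (inverse z - z) * ?U n"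
    by (simp add: cpoly_diff cpoly_mult map_poly_pCons algebra_simps)
  also have "\<dots> = inverse z ^ Suc (Suc n) - z ^ Suc (Suc n)"
    unfolding 3 using assms by (simp add: field_simps)
  finally show ?case .
qed (auto simp: map_poly_pCons)

lemma cheb_u_degree: "degree (cheb_u n) \<le> n - 1 \<and> (n \<ge> 1 \<longrightarrow> coeff (cheb_u n) (n - 1) = 1)"
proof (induction n rule: cheb_u.induct)
  case (3 n)
  have "degree ([:0, 1:] * cheb_u (Suc n) - cheb_u n) \<le> Suc n"
    using 3 by (intro degree_diff_le order_trans[OF degree_mult_le]) auto
  moreover have "coeff (cheb_u n) (Suc n) = 0" using 3 by (intro coeff_eq_0) auto
  ultimately show ?case using 3 by simp
qed auto

text \<open>The regular solution that a finitely supported perturbation with Jost function f must have beyond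
its support, see the evaluation below. Expanding f turns it into Chebyshev polynomials; a negative
index x - i contributes with the opposite sign.\<close>

definition bernstein_szego :: "real poly \<Rightarrow> nat \<Rightarrow> real poly" where
  "bernstein_szego f x = (\<Sum>i\<le>degree f.
     smult (coeff f i) (if i \<le> x then cheb_u (x - i) else - cheb_u (i - x)))"

lemma bernstein_szego_eval:
  assumes z: "z \<noteq> 0"
  shows "(inverse z - z) * poly (cpoly (bernstein_szego f x)) (z + inverse z) =
    poly (cpoly f) z * inverse z ^ x - poly (cpoly f) (inverse z) * z ^ x"
proof -
  have uminus: "cpoly (- g) = - cpoly g" for g by (rule poly_eqI) (simp add: coeff_map_poly)
  have "(inverse z - z) * poly (cpoly (if i \<le> x then cheb_u (x - i) else - cheb_u (i - x))) (z + inverse z)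
    = z ^ i * inverse z ^ x - inverse z ^ i * z ^ x" for i
  proof (cases "i \<le> x")
    case True
    hence "inverse z ^ (x - i) - z ^ (x - i) = z ^ i * inverse z ^ x - inverse z ^ i * z ^ x"
      using z by (simp add: power_diff field_simps)
    thus ?thesis using True by (simp add: cheb_u_eval[OF z])
  next
    case False
    hence "inverse z ^ (i - x) - z ^ (i - x) = - (z ^ i * inverse z ^ x - inverse z ^ i * z ^ x)"
      using z by (simp add: power_diff field_simps)
    thus ?thesis using False by (simp add: uminus cheb_u_eval[OF z])
  qed
  hence "(inverse z - z) * poly (cpoly (bernstein_szego f x)) (z + inverse z) =
    (\<Sum>i\<le>degree f. of_real (coeff f i) * (z ^ i * inverse z ^ x - inverse z ^ i * z ^ x))"
    by (simp add: bernstein_szego_def cpoly_sum poly_sum cpoly_smult sum_distrib_left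
        mult.left_commute[of "inverse z - z"])
  also have "\<dots> = poly (cpoly f) z * inverse z ^ x - poly (cpoly f) (inverse z) * z ^ x"
    unfolding poly_cpoly_altdef sum_distrib_right sum_subtractf[symmetric]
    by (intro sum.cong) (auto simp: algebra_simps)
  finally show ?thesis .
qed

text \<open>Only the constant term of f reaches the degree x - 1: the index x - i of every other term has modulus
at most x - 1, because the degree of f is at most 2x - 2.\<close>

lemma bernstein_szego_degree:
  assumes "degree f \<le> 2 * x - 2" "x \<ge> 2" "coeff f 0 \<noteq> 0"
  shows "degree (bernstein_szego f x) = x - 1" "coeff (bernstein_szego f x) (x - 1) = coeff f 0"
proof -
  let ?V = "\<lambda>i. if i \<le> x then cheb_u (x - i) else - cheb_u (i - x)"
  have V: "degree (?V i) \<le> x - 2" if "i \<noteq> 0" "i \<le> degree f" for i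
    using cheb_u_degree[of "x - i"] cheb_u_degree[of "i - x"] that assms by auto
  have deg: "degree (bernstein_szego f x) \<le> x - 1"
    unfolding bernstein_szego_def
  proof (intro degree_sum_le)
    fix i assume "i \<in> {..degree f}"
    thus "degree (smult (coeff f i) (?V i)) \<le> x - 1"
      using V[of i] cheb_u_degree[of x] by (cases "i = 0") (auto intro: order_trans[OF degree_smult_le])
  qed auto
  have "coeff (bernstein_szego f x) (x - 1) = (\<Sum>i\<le>degree f. coeff f i * coeff (?V i) (x - 1))"
    by (simp add: bernstein_szego_def coeff_sum)
  also have "\<dots> = (\<Sum>i\<in>{0}. coeff f i * coeff (?V i) (x - 1))"
  proof (intro sum.mono_neutral_right ballI)
    fix i assume "i \<in> {..degree f} - {0}"
    hence "degree (?V i) < x - 1" using V[of i] assms(2) by auto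
    thus "coeff f i * coeff (?V i) (x - 1) = 0" by (simp only: coeff_eq_0 mult_zero_right)
  qed auto
  also have "\<dots> = coeff f 0" using cheb_u_degree[of x] assms(2) by simp
  finally show c: "coeff (bernstein_szego f x) (x - 1) = coeff f 0" .
  show "degree (bernstein_szego f x) = x - 1"
    using deg c assms(3) by (intro antisym le_degree) auto
qed

lemma bernstein_szego_degree_le: "degree (bernstein_szego f x) \<le> max x (degree f - x) - 1"
  unfolding bernstein_szego_def
proof (intro degree_sum_le)
  fix i assume "i \<in> {..degree f}"
  thus "degree (smult (coeff f i) (if i \<le> x then cheb_u (x - i) else - cheb_u (i - x)))
      \<le> max x (degree f - x) - 1"
    using cheb_u_degree[of "x - i"] cheb_u_degree[of "i - x"]
    by (intro order_trans[OF degree_smult_le]) auto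
qed auto

lemma bernstein_szego_rec:
  "[:0, 1:] * bernstein_szego f (Suc x) = bernstein_szego f (Suc (Suc x)) + bernstein_szego f x"
proof -
  have "cpoly ([:0, 1:] * bernstein_szego f (Suc x) - bernstein_szego f (Suc (Suc x)) - bernstein_szego f x) = 0"
    (is "?P = 0")
  proof (rule ccontr)
    assume "?P \<noteq> 0"
    have zero: "poly ?P (z + inverse z) = 0" if z: "z \<noteq> 0" "inverse z \<noteq> z" for z
    proof -
      let ?B = "\<lambda>x. (inverse z - z) * poly (cpoly (bernstein_szego f x)) (z + inverse z)"
      have "(inverse z - z) * poly ?P (z + inverse z) =
        (z + inverse z) * ?B (Suc x) - ?B (Suc (Suc x)) - ?B x"
        by (simp only: cpoly_diff cpoly_mult poly_diff poly_mult poly_cpoly_X right_diff_distrib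
            mult.left_commute)
      also have "\<dots> = 0"
        unfolding bernstein_szego_eval[OF z(1)] using z(1) by (simp add: field_simps)
      finally show ?thesis using z(2) by simp
    qed
    have "finite {z. poly ?P z = 0}" by (rule poly_roots_finite) fact
    moreover have "(\<lambda>x. of_real (x + inverse x)) ` {0<..<1} \<subseteq> {z. poly ?P z = 0}"
    proof safe
      fix x :: real assume x: "x \<in> {0<..<1}"
      hence "inverse x \<noteq> x" by (metis greaterThanLessThan_iff less_asym one_less_inverse)
      thus "poly ?P (of_real (x + inverse x)) = 0"
        using zero[of "of_real x"] x by (simp flip: of_real_inverse)
    qed
    moreover have "inj_on (\<lambda>x::real. complex_of_real (x + inverse x)) {0<..<1}"
    proof (rule inj_onI)
      fix x y :: real assume xy: "x \<in> {0<..<1}" "y \<in> {0<..<1}"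
        "complex_of_real (x + inverse x) = complex_of_real (y + inverse y)"
      hence "x + inverse x = y + inverse y" by (simp only: of_real_eq_iff)
      hence "(x - y) * (1 - x * y) = 0" using xy(1,2) by (simp add: field_simps)
      moreover have "x * y < 1" using xy(1,2) by (metis greaterThanLessThan_iff less_imp_le
          mult_strict_mono' mult_1 zero_less_one)
      ultimately show "x = y" by simp
    qed
    ultimately show False using infinite_Ioo[of 0 "1::real"] by (meson finite_imageD finite_subset zero_less_one)
  qed
  hence "[:0, 1:] * bernstein_szego f (Suc x) - bernstein_szego f (Suc (Suc x)) - bernstein_szego f x = 0"
    by (simp only: cpoly_eq_0_iff)
  thus ?thesis by (simp only: diff_diff_eq right_minus_eq)
qed

section \<open>The spectral functional\<close>

text \<open>The density of the spectral measure in the variable t, where \<lambda> = 2 cos t, up to a constant factor.\<close>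

definition spectral_weight :: "real poly \<Rightarrow> real \<Rightarrow> real" where
  "spectral_weight f t = 4 * (sin t)\<^sup>2 / (cmod (poly (cpoly f) (cis t)))\<^sup>2"

text \<open>Up to a constant factor this is integration against the spectral measure of the operator that is to
be constructed. The masses at s + 1/s are those for which the residues cancel in the orthogonality
relations below.\<close>

definition spectral_functional :: "real poly \<Rightarrow> real set \<Rightarrow> real poly \<Rightarrow> real" where
  "spectral_functional f S P = integral {0..2*pi} (\<lambda>t. poly P (2 * cos t) * spectral_weight f t)
     + (\<Sum>s\<in>S. 4 * pi * (s - inverse s)\<^sup>2 / (s * poly (pderiv f) s * poly f (inverse s))
          * poly P (s + inverse s))"

text \<open>The sign rule implies that the zeros in S are nonzero and simple. There are no zeros on the unit
circle, so that the weight is continuous.\<close>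

definition jost_like :: "real poly \<Rightarrow> real set \<Rightarrow> bool" where
  "jost_like f S \<longleftrightarrow> finite S \<and> poly f 0 > 0 \<and>
     (\<forall>z. norm z \<le> 1 \<longrightarrow> (poly (cpoly f) z = 0 \<longleftrightarrow> z \<in> of_real ` S)) \<and>
     (\<forall>s\<in>S. \<bar>s\<bar> < 1 \<and> s * poly (pderiv f) s * poly f (inverse s) > 0)"

lemma jost_like_nonzero_circle: "jost_like f S \<Longrightarrow> poly (cpoly f) (cis t) \<noteq> 0"
  unfolding jost_like_def
  by (metis (no_types, lifting) abs_norm_cancel imageE less_irrefl norm_cis norm_of_real order_refl)

lemma continuous_spectral:
  assumes "jost_like f S"
  shows "continuous_on A (\<lambda>t. poly P (2 * cos t) * spectral_weight f t)"
proof -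
  have "continuous_on A cis" by (rule continuous_on_cis) (rule continuous_on_id)
  thus ?thesis unfolding spectral_weight_def
    using jost_like_nonzero_circle[OF assms] by (intro continuous_intros) auto
qed

lemma spectral_functional_add:
  assumes "jost_like f S"
  shows "spectral_functional f S (P + Q) = spectral_functional f S P + spectral_functional f S Q"
  unfolding spectral_functional_def
  by (simp add: distrib_right distrib_left sum.distrib integral_add
      integrable_continuous_real continuous_spectral[OF assms])

lemma spectral_functional_smult:
  "spectral_functional f S (smult c P) = c * spectral_functional f S P"
  by (simp add: spectral_functional_def mult.assoc sum_distrib_left algebra_simps)

lemma spectral_functional_pos:
  assumes f: "jost_like f S" and P: "P \<noteq> 0"
  shows "spectral_functional f S (P * P) > 0"
proof -
  let ?g = "\<lambda>t. poly (P * P) (2 * cos t) * spectral_weight f t"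
  have nonneg: "?g t \<ge> 0" for t by (simp add: spectral_weight_def)
  have "integral {0..2*pi} ?g \<noteq> 0"
  proof
    assume "integral {0..2*pi} ?g = 0"
    hence z: "\<forall>t\<in>{0..2*pi}. ?g t = 0"
      using integral_eq_0_iff[OF continuous_spectral[OF f], of 0 "2 * pi" "P * P"] nonneg by simp
    have "P = 0"
    proof (rule real_poly_eqI[of "-2" 2])
      fix y :: real assume y: "-2 < y" "y < 2"
      define t where "t = arccos (y / 2)"
      have t: "0 < t" "t < pi" using y arccos_lt_bounded[of "y / 2"] by (auto simp: t_def)
      have "2 * cos t = y" using y by (simp add: t_def)
      moreover have "sin t > 0" using t by (rule sin_gt_zero)
      moreover have "?g t = 0" using z t by auto
      ultimately show "poly P y = poly 0 y"
        using jost_like_nonzero_circle[OF f, of t] by (simp add: spectral_weight_def)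
    qed simp
    thus False using P by contradiction
  qed
  moreover have "integral {0..2*pi} ?g \<ge> 0"
    using nonneg by (intro integral_nonneg integrable_continuous_real continuous_spectral[OF f]) auto
  moreover have "(\<Sum>s\<in>S. 4 * pi * (s - inverse s)\<^sup>2 / (s * poly (pderiv f) s * poly f (inverse s))
          * poly (P * P) (s + inverse s)) \<ge> 0"
  proof (rule sum_nonneg)
    fix s assume "s \<in> S"
    hence "s * poly (pderiv f) s * poly f (inverse s) > 0" using f by (simp add: jost_like_def)
    thus "4 * pi * (s - inverse s)\<^sup>2 / (s * poly (pderiv f) s * poly f (inverse s))
          * poly (P * P) (s + inverse s) \<ge> 0"
      by (intro mult_nonneg_nonneg divide_nonneg_pos) auto
  qed
  ultimately show ?thesis by (simp add: spectral_functional_def)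
qed

lemma bernstein_szego_eval_real:
  fixes s :: real
  assumes "s \<noteq> 0"
  shows "(inverse s - s) * poly (bernstein_szego f x) (s + inverse s) =
    poly f s * inverse s ^ x - poly f (inverse s) * s ^ x"
proof -
  have "complex_of_real ((inverse s - s) * poly (bernstein_szego f x) (s + inverse s)) =
     of_real (poly f s * inverse s ^ x - poly f (inverse s) * s ^ x)"
    using bernstein_szego_eval[of "of_real s" f x] assms
    by (simp flip: poly_cpoly_of_real)
  thus ?thesis by (simp only: of_real_eq_iff)
qed

text \<open>Multiplication of a Bernstein-Szego polynomial with the weight thus cancels a factor of |f|^2 and
leaves the imaginary part of z^x / f, whose integral is accessible to the residue theorem.\<close>

lemma bernstein_szego_on_circle:
  "sin t * poly (bernstein_szego f x) (2 * cos t) = - Im (poly (cpoly f) (cis t) * cnj (cis t ^ x))"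
proof -
  let ?z = "cis t" and ?B = "poly (bernstein_szego f x) (2 * cos t)"
  define w where "w = poly (cpoly f) ?z * cnj (?z ^ x)"
  have "?z + inverse ?z = of_real (2 * cos t)" by (simp add: complex_eq_iff)
  hence "(inverse ?z - ?z) * of_real ?B = w - cnj w" unfolding w_def
    using bernstein_szego_eval[of ?z f x] by (simp only: poly_cpoly_of_real cis_neq_zero)
     (simp add: cis_cnj flip: poly_cpoly_cnj)
  from arg_cong[OF this, of Im] have "sin t * ?B = - Im w" by simp
  thus ?thesis by (simp only: w_def)
qed

text \<open>The degree condition is what makes the Laurent polynomial on the right a polynomial: it excludes a
pole at 0.\<close>

lemma orthogonality_numerator:
  assumes "degree P + 2 \<le> x"
  obtains H where "\<And>z. z \<noteq> 0 \<Longrightarrow>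
    poly (cpoly H) z = poly (cpoly P) (z + inverse z) * (z - inverse z) * z ^ (x - 1)"
proof
  let ?H = "\<Sum>i\<le>degree P. smult (coeff P i) ([:1, 0, 1:] ^ i * monom 1 (x - 2 - i) * [:-1, 0, 1:])"
  fix z :: complex assume z: "z \<noteq> 0"
  have monom: "poly (cpoly (monom 1 n)) z = z ^ n" for n
    by (simp add: map_poly_monom poly_monom)
  have "poly (cpoly ?H) z = (\<Sum>i\<le>degree P. of_real (coeff P i) *
      ((1 + z * z) ^ i * z ^ (x - 2 - i) * (z * z - 1)))"
    by (simp add: cpoly_sum cpoly_smult cpoly_mult cpoly_power poly_sum monom map_poly_pCons
        del: mult_pCons_right)
  also have "\<dots> = (\<Sum>i\<le>degree P. of_real (coeff P i) * (z + inverse z) ^ i * (z - inverse z) * z ^ (x - 1))"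
  proof (intro sum.cong refl)
    fix i assume "i \<in> {..degree P}"
    then obtain d where d: "x = i + d + 2" using assms by (metis add.commute add_leD2 atMost_iff
       le_Suc_ex le_trans nat_add_left_cancel_le add.assoc)
    have "1 + z * z = z * (z + inverse z)" "z * z - 1 = z * (z - inverse z)"
      using z by (simp_all add: field_simps)
    thus "of_real (coeff P i) * ((1 + z * z) ^ i * z ^ (x - 2 - i) * (z * z - 1)) =
        of_real (coeff P i) * (z + inverse z) ^ i * (z - inverse z) * z ^ (x - 1)"
      by (simp add: d power_add power_mult_distrib)
  qed
  also have "\<dots> = poly (cpoly P) (z + inverse z) * (z - inverse z) * z ^ (x - 1)"
    by (simp add: poly_cpoly_altdef sum_distrib_right)
  finally show "poly (cpoly ?H) z = poly (cpoly P) (z + inverse z) * (z - inverse z) * z ^ (x - 1)" .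
qed

text \<open>On the circle the integrand is a multiple of the imaginary part of H(z) i z / f(z), where H is the
polynomial numerator P(\<lambda>) (z - 1/z) z^(x - 1). Its integral is a sum of residues at the zeros in the
disc, and the point masses contribute the negative of the same sum.\<close>

lemma bernstein_szego_orthogonal:
  assumes f: "jost_like f S" and deg: "degree P + 2 \<le> x"
  shows "spectral_functional f S (bernstein_szego f x * P) = 0"
proof -
  let ?F = "cpoly f" and ?B = "bernstein_szego f x"
  obtain H where H: "\<And>z. z \<noteq> 0 \<Longrightarrow>
    poly (cpoly H) z = poly (cpoly P) (z + inverse z) * (z - inverse z) * z ^ (x - 1)"
    using orthogonality_numerator[OF deg] by blast
  have f0: "poly f 0 \<noteq> 0" and S: "\<And>s. s \<in> S \<Longrightarrow> \<bar>s\<bar> < 1"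
    "\<And>s. s \<in> S \<Longrightarrow> s * poly (pderiv f) s * poly f (inverse s) > 0"
    using f by (auto simp: jost_like_def)
  have root: "poly f s = 0" if "s \<in> S" for s
  proof -
    have "cmod (of_real s) \<le> 1" using S(1)[OF that] by simp
    hence "poly ?F (of_real s) = 0" using f that unfolding jost_like_def by blast
    thus ?thesis by (simp add: poly_cpoly_of_real)
  qed
  have s0: "s \<noteq> 0" if "s \<in> S" for s using S(2)[OF that] by auto
  have pd: "pderiv ?F = cpoly (pderiv f)"
    by (rule poly_eqI) (simp add: coeff_pderiv coeff_map_poly)
  define c where "c = (\<Sum>s\<in>S. poly H s / poly (pderiv f) s)"
  have "((\<lambda>t. poly (cpoly H) (cis t) / poly ?F (cis t) * \<i> * cis t) has_integral
    2 * pi * \<i> * (\<Sum>s\<in>of_real ` S. poly (cpoly H) s / poly (pderiv ?F) s)) {0..2*pi}"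
  proof (rule circle_integral_simple_poles)
    show "poly (pderiv ?F) s \<noteq> 0" if "s \<in> of_real ` S" for s
      using that S(2) by (force simp: pd poly_cpoly_of_real)
  qed (use f in \<open>auto simp: jost_like_def\<close>)
  also have "(\<Sum>s\<in>of_real ` S. poly (cpoly H) s / poly (pderiv ?F) s) = of_real c"
    by (subst sum.reindex) (auto simp: inj_on_def c_def pd poly_cpoly_of_real)
  finally have "((\<lambda>t. Im (poly (cpoly H) (cis t) / poly ?F (cis t) * \<i> * cis t)) has_integral
    Im (2 * pi * \<i> * of_real c)) {0..2*pi}"
    by (rule has_integral_Im)
  hence "((\<lambda>t. -2 * Im (poly (cpoly H) (cis t) / poly ?F (cis t) * \<i> * cis t)) has_integral
    -2 * Im (2 * pi * \<i> * of_real c)) {0..2*pi}"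
    by (rule has_integral_mult_right)
  also have "(\<lambda>t. -2 * Im (poly (cpoly H) (cis t) / poly ?F (cis t) * \<i> * cis t)) =
      (\<lambda>t. poly (?B * P) (2 * cos t) * spectral_weight f t)"
  proof
    fix t
    let ?z = "cis t" and ?p = "poly P (2 * cos t)"
    have x: "x = Suc (x - 1)" using deg by simp
    have Im_cnj: "Im (cnj w / of_real r) = - Im w / r" for w r by simp
    have Fn: "poly ?F ?z \<noteq> 0" using jost_like_nonzero_circle[OF f] .
    have "?z + inverse ?z = of_real (2 * cos t)" "?z - inverse ?z = of_real (2 * sin t) * \<i>"
      by (simp_all add: complex_eq_iff)
    hence "poly (cpoly H) ?z / poly ?F ?z * \<i> * ?z =
       of_real ?p * (of_real (2 * sin t) * \<i>) * ?z ^ (x - 1) / poly ?F ?z * \<i> * ?z"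
      using H[of ?z] by (simp only: poly_cpoly_of_real cis_neq_zero) simp
    also have "\<dots> = of_real (-2 * sin t * ?p) * (?z ^ x / poly ?F ?z)"
      by (subst x) (simp add: algebra_simps)
    also have "?z ^ x / poly ?F ?z = cnj (poly ?F ?z * cnj (?z ^ x)) / of_real ((cmod (poly ?F ?z))\<^sup>2)"
      using Fn by (simp add: complex_norm_square field_simps del: of_real_power)
    finally have "-2 * Im (poly (cpoly H) ?z / poly ?F ?z * \<i> * ?z) =
       4 * sin t * ?p * Im (cnj (poly ?F ?z * cnj (?z ^ x)) / of_real ((cmod (poly ?F ?z))\<^sup>2))"
      by (simp only: Im_complex_of_real Re_complex_of_real times_complex.sel) simp
    also have "\<dots> = 4 * sin t * ?p * (sin t * poly ?B (2 * cos t)) / (cmod (poly ?F ?z))\<^sup>2"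
      unfolding bernstein_szego_on_circle Im_cnj by simp
    finally show "-2 * Im (poly (cpoly H) ?z / poly ?F ?z * \<i> * ?z) =
        poly (?B * P) (2 * cos t) * spectral_weight f t"
      by (simp add: spectral_weight_def power2_eq_square mult_ac)
  qed
  finally have int: "integral {0..2*pi} (\<lambda>t. poly (?B * P) (2 * cos t) * spectral_weight f t) = - 4 * pi * c"
    by (simp add: integral_unique)
  have "(\<Sum>s\<in>S. 4 * pi * (s - inverse s)\<^sup>2 / (s * poly (pderiv f) s * poly f (inverse s))
          * poly (?B * P) (s + inverse s)) = (\<Sum>s\<in>S. 4 * pi * (poly H s / poly (pderiv f) s))"
  proof (rule sum.cong[OF refl])
    fix s assume s: "s \<in> S"
    have x: "x = Suc (x - 1)" using deg by simp
    have ne: "poly f (inverse s) \<noteq> 0" "poly (pderiv f) s \<noteq> 0" "s \<noteq> 0" using S(2)[OF s] by auto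
    have "complex_of_real (poly H s) = of_real (poly P (s + inverse s) * (s - inverse s) * s ^ (x - 1))"
      using H[of "of_real s"] ne by (simp flip: poly_cpoly_of_real)
    hence Hs: "poly H s = poly P (s + inverse s) * (s - inverse s) * s ^ (x - 1)"
      by (simp only: of_real_eq_iff)
    have "(s - inverse s) * poly ?B (s + inverse s) = poly f (inverse s) * s ^ x"
      using bernstein_szego_eval_real[OF ne(3), of f x] root[OF s] by (simp add: algebra_simps)
    hence "4 * pi * (s - inverse s)\<^sup>2 * poly (?B * P) (s + inverse s) =
      4 * pi * (s - inverse s) * (poly f (inverse s) * s ^ x) * poly P (s + inverse s)"
      by (simp add: power2_eq_square)
    also have "\<dots> = 4 * pi * (s * poly f (inverse s)) * poly H s"
      unfolding Hs by (subst x) simp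
    finally show "4 * pi * (s - inverse s)\<^sup>2 / (s * poly (pderiv f) s * poly f (inverse s))
          * poly (?B * P) (s + inverse s) = 4 * pi * (poly H s / poly (pderiv f) s)"
      using ne by (simp add: field_simps)
  qed
  also have "\<dots> = 4 * pi * c" by (simp add: c_def sum_distrib_left)
  finally show ?thesis using int by (simp add: spectral_functional_def)
qed

section \<open>Recovering the operator\<close>

lemma orthogonal_lead:
  fixes L :: "real poly \<Rightarrow> real"
  assumes add: "\<And>P Q. L (P + Q) = L P + L Q" and smult: "\<And>c P. L (smult c P) = c * L P"
    and deg: "degree B \<le> n" and orth: "\<And>P. degree P < n \<Longrightarrow> L (A * P) = 0"
  shows "L (A * B) = coeff B n * L (A * monom 1 n)"
proof -
  define R where "R = B - smult (coeff B n) (monom 1 n)"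
  have "L (A * R) = 0"
  proof (cases "R = 0")
    case True
    thus ?thesis using smult[of 0 0] by simp
  next
    case False
    have "coeff R i = 0" if "i \<ge> n" for i
      using that deg by (cases "i = n") (auto simp: R_def coeff_eq_0)
    hence "degree R < n" using False by (meson leading_coeff_0_iff not_le)
    thus ?thesis by (rule orth)
  qed
  moreover have "A * B = A * R + smult (coeff B n) (A * monom 1 n)"
    by (simp add: R_def algebra_simps)
  ultimately show ?thesis by (simp add: add smult)
qed

text \<open>In the step from n to n + 1, C = (\<lambda> - b) B - \<alpha> A, with b chosen to cancel the coefficient next to the top one, has
degree at most n and is orthogonal to all polynomials of degree less than n. Moreover
L(C \<lambda>^n) = L(B \<lambda>^(n + 1)) > 0, so C \<noteq> 0, and L(C C) > 0 then shows that the coefficient of \<lambda>^n in C is positive.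
Hence C = \<beta> C' with \<beta> > 0, where \<beta> is determined by the requirement that \<alpha> and \<beta> both equal the
quotient of consecutive leading coefficients.\<close>

lemma downward_recursion:
  fixes L :: "real poly \<Rightarrow> real"
  assumes add: "\<And>P Q. L (P + Q) = L P + L Q" and smult: "\<And>c P. L (smult c P) = c * L P"
    and pos: "\<And>P. P \<noteq> 0 \<Longrightarrow> L (P * P) > 0"
    and "degree A = Suc n" "degree B = n" "lead_coeff B > 0" "\<alpha> > 0"
    and "\<alpha> * lead_coeff A = lead_coeff B"
    and "\<And>P. degree P \<le> n \<Longrightarrow> L (A * P) = 0" "\<And>P. degree P < n \<Longrightarrow> L (B * P) = 0"
  shows "\<exists>a b \<phi>. a 0 = 1 \<and> (\<forall>x. a x > 0) \<and> \<phi> (n + 2) = A \<and> \<phi> (n + 1) = B \<and> a (n + 1) = \<alpha> \<and>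
    \<phi> 0 = 0 \<and> (\<exists>c>0. \<phi> 1 = [:c:]) \<and> (\<forall>x\<in>{1..n+2}. degree (\<phi> x) = x - 1) \<and>
    (\<forall>x\<in>{1..n+1}. [:0, 1:] * \<phi> x =
       smult (a x) (\<phi> (x + 1)) + smult (b x) (\<phi> x) + smult (a (x - 1)) (\<phi> (x - 1)))"
  using assms(4-)
proof (induction n arbitrary: A B \<alpha>)
  case 0
  obtain c where c: "B = [:c:]" "c > 0" using 0 by (metis degree_eq_zeroE lead_coeff_pCons(2))
  obtain d e where A: "A = [:d, e:]" using 0(1) by (metis One_nat_def degree_eq_zeroE
     degree_pCons_eq_if old.nat.inject pCons_cases zero_neq_one)
  have e: "\<alpha> * e = c" using 0 c A by (auto split: if_splits)
  show ?case
    by (rule exI[of _ "(\<lambda>_. 1)(1 := \<alpha>)"], rule exI[of _ "\<lambda>_. - \<alpha> * d / c"],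
        rule exI[of _ "(\<lambda>_. 0)(1 := B, 2 := A)"])
      (use 0 c A e in \<open>auto simp: numeral_2_eq_2 le_Suc_eq\<close>)
next
  case (Suc n)
  define \<beta>0 where "\<beta>0 = (coeff B n - \<alpha> * coeff A (Suc n)) / lead_coeff B"
  define C where "C = [:- \<beta>0, 1:] * B - smult \<alpha> A"
  have degC: "degree C \<le> n"
  proof (rule degree_le, intro allI impI)
    fix i assume "i > n"
    then consider "i = Suc n" | "i = Suc (Suc n)" | "i > Suc (Suc n)" by linarith
    thus "coeff C i = 0"
    proof cases
      case 1
      thus ?thesis using Suc.prems by (simp add: C_def \<beta>0_def field_simps)
    next
      case 2
      thus ?thesis using Suc.prems by (simp add: C_def coeff_eq_0)
    next
      case 3
      then obtain j where "i = Suc j" "j > Suc n" by (cases i) auto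
      thus ?thesis using Suc.prems by (simp add: C_def coeff_eq_0)
    qed
  qed
  have uminus: "L (- P) = - L P" for P using smult[of "-1" P] by simp
  have LC: "L (C * P) = L (B * ([:- \<beta>0, 1:] * P)) - \<alpha> * L (A * P)" for P
  proof -
    obtain X where X: "X = [:- \<beta>0, 1:]" by blast
    have "C * P = B * ([:- \<beta>0, 1:] * P) + smult (- \<alpha>) (A * P)"
      unfolding C_def X[symmetric] by (simp add: algebra_simps)
    thus ?thesis by (simp only: add smult)
  qed
  have orthC: "L (C * P) = 0" if "degree P < n" for P
  proof -
    have "degree ([:- \<beta>0, 1:] * P) < Suc n"
      using that by (intro le_less_trans[OF degree_mult_le]) simp
    thus ?thesis using Suc.prems(7) Suc.prems(6)[of P] that by (simp only: LC)
  qed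
  have "L (B * monom 1 (Suc n)) > 0"
  proof -
    have "L (B * B) = lead_coeff B * L (B * monom 1 (Suc n))"
      using orthogonal_lead[of L B "Suc n" B, OF add smult _ Suc.prems(7)] Suc.prems(2) by simp
    moreover have "L (B * B) > 0" using Suc.prems(3) by (intro pos) auto
    ultimately show ?thesis using Suc.prems(3) by (simp add: zero_less_mult_iff)
  qed
  moreover have "L (C * monom 1 n) = L (B * monom 1 (Suc n))"
  proof -
    have "L (C * monom 1 n) = L (B * ([:- \<beta>0, 1:] * monom 1 n))"
      using Suc.prems(6)[of "monom 1 n"] by (simp add: LC degree_monom_eq)
    also have "\<dots> = coeff ([:- \<beta>0, 1:] * monom 1 n) (Suc n) * L (B * monom 1 (Suc n))"
    proof (rule orthogonal_lead[OF add smult _ Suc.prems(7)])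
      show "degree ([:- \<beta>0, 1:] * monom 1 n) \<le> Suc n"
        by (rule order_trans[OF degree_mult_le]) (simp add: degree_monom_eq)
    qed
    also have "coeff ([:- \<beta>0, 1:] * monom 1 n) (Suc n) = 1" by simp
    finally show ?thesis by simp
  qed
  ultimately have Cpos: "L (C * monom 1 n) > 0" by simp
  have "C \<noteq> 0" using Cpos smult[of 0 0] by auto
  hence "L (C * C) > 0" by (rule pos)
  moreover have "L (C * C) = coeff C n * L (C * monom 1 n)"
    by (rule orthogonal_lead[OF add smult degC orthC])
  ultimately have c: "coeff C n > 0" using Cpos by (simp add: zero_less_mult_iff)
  hence dC: "degree C = n" using degC by (intro antisym le_degree) auto
  \<comment> \<open>the solution of \<beta> lead(B) = lead(C / \<beta>)\<close>
  define \<beta> where "\<beta> = sqrt (coeff C n / lead_coeff B)"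
  have \<beta>: "\<beta> > 0" "\<beta> * \<beta> = coeff C n / lead_coeff B"
    using c Suc.prems(3) by (auto simp: \<beta>_def)
  define C' where "C' = smult (inverse \<beta>) C"
  have "\<beta> * \<beta> * lead_coeff B = coeff C n" using Suc.prems(3) by (auto simp: \<beta>(2))
  hence "inverse \<beta> * coeff C n = \<beta> * lead_coeff B" using \<beta>(1) by (simp add: field_simps)
  hence C': "degree C' = n" "lead_coeff C' > 0" "\<beta> * lead_coeff B = lead_coeff C'"
    using \<beta>(1) c dC Suc.prems(3) by (auto simp: C'_def)
  have CC': "C = smult \<beta> C'" using \<beta> by (simp add: C'_def)
  have "\<exists>a b \<phi>. a 0 = 1 \<and> (\<forall>x. a x > 0) \<and> \<phi> (n + 2) = B \<and> \<phi> (n + 1) = C' \<and> a (n + 1) = \<beta> \<and>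
    \<phi> 0 = 0 \<and> (\<exists>c>0. \<phi> 1 = [:c:]) \<and> (\<forall>x\<in>{1..n+2}. degree (\<phi> x) = x - 1) \<and>
    (\<forall>x\<in>{1..n+1}. [:0, 1:] * \<phi> x =
       smult (a x) (\<phi> (x + 1)) + smult (b x) (\<phi> x) + smult (a (x - 1)) (\<phi> (x - 1)))"
  proof (rule Suc.IH[OF Suc.prems(2) C'(1,2) \<beta>(1) C'(3)])
    show "L (B * P) = 0" if "degree P \<le> n" for P using that Suc.prems(7) by simp
    show "L (C' * P) = 0" if "degree P < n" for P using orthC[OF that] by (simp add: C'_def smult)
  qed
  then obtain a b \<phi> where H: "a 0 = 1" "\<forall>x. a x > 0" "\<phi> (n + 2) = B" "\<phi> (n + 1) = C'"
    "a (n + 1) = \<beta>" "\<phi> 0 = 0" "\<exists>c>0. \<phi> 1 = [:c:]" "\<forall>x\<in>{1..n+2}. degree (\<phi> x) = x - 1"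
    "\<forall>x\<in>{1..n+1}. [:0, 1:] * \<phi> x =
       smult (a x) (\<phi> (x + 1)) + smult (b x) (\<phi> x) + smult (a (x - 1)) (\<phi> (x - 1))"
    by blast
  let ?a = "a(n + 2 := \<alpha>)" and ?b = "b(n + 2 := \<beta>0)" and ?\<phi> = "\<phi>(n + 3 := A)"
  have top: "[:0, 1:] * B = smult \<alpha> A + smult \<beta>0 B + smult \<beta> C'"
    unfolding CC'[symmetric] C_def by simp
  have rec: "[:0, 1:] * ?\<phi> x =
       smult (?a x) (?\<phi> (x + 1)) + smult (?b x) (?\<phi> x) + smult (?a (x - 1)) (?\<phi> (x - 1))"
    if "x \<in> {1..Suc n + 1}" for x
  proof (cases "x = n + 2")
    case True
    thus ?thesis using top H(3,4,5) by (simp add: eval_nat_numeral)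
  next
    case False
    hence "x \<in> {1..n+1}" using that by auto
    thus ?thesis using bspec[OF H(9), of x] by auto
  qed
  show ?case
  proof (rule exI[of _ ?a], rule exI[of _ ?b], rule exI[of _ ?\<phi>], intro conjI ballI)
    show "degree (?\<phi> x) = x - 1" if "x \<in> {1..Suc n + 2}" for x
      using that H(8) Suc.prems(1) by auto
  qed (use H Suc.prems(4) rec in \<open>auto simp: eval_nat_numeral\<close>)
qed

text \<open>The coefficients come from the downward recursion started at \<phi>_(p+2) and \<phi>_(p+1). Since the free
recurrence holds above, a and b are trivial beyond p. The Wronskian of the regular solution \<phi> and the
Jost solution is \<phi>_1 \<psi>_0 at 0 and f at p + 1, whence f = \<phi>_1 \<psi>_0 with a positive constant \<phi>_1.\<close>

lemma jost_factor_realizes: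
  assumes p: "p \<ge> 1" and deg: "degree f \<le> 2 * p" and f: "jost_like f S"
  obtains a b c where "a 0 = 1" "\<And>x. a x > 0" "\<forall>x>p. a x = 1 \<and> b x = 0" "c > 0"
    "f = smult c (jost_factor a b p 0)"
proof -
  let ?L = "spectral_functional f S" and ?B = "bernstein_szego f"
  have f0: "coeff f 0 > 0" using f by (simp add: jost_like_def poly_0_coeff_0)
  have B: "degree (?B x) = x - 1" "coeff (?B x) (x - 1) = coeff f 0" if "x > p" for x
    using bernstein_szego_degree[of f x] that p deg f0 by auto
  have "\<exists>a b \<phi>. a 0 = 1 \<and> (\<forall>x. a x > 0) \<and> \<phi> (p + 2) = ?B (p + 2) \<and> \<phi> (p + 1) = ?B (p + 1) \<and>
    a (p + 1) = 1 \<and> \<phi> 0 = 0 \<and> (\<exists>c>0. \<phi> 1 = [:c:]) \<and> (\<forall>x\<in>{1..p+2}. degree (\<phi> x) = x - 1) \<and>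
    (\<forall>x\<in>{1..p+1}. [:0, 1:] * \<phi> x =
       smult (a x) (\<phi> (x + 1)) + smult (b x) (\<phi> x) + smult (a (x - 1)) (\<phi> (x - 1)))"
  proof (rule downward_recursion[of ?L])
    show "?L (?B (p + 2) * P) = 0" if "degree P \<le> p" for P
      using that by (intro bernstein_szego_orthogonal[OF f]) simp
    show "?L (?B (p + 1) * P) = 0" if "degree P < p" for P
      using that by (intro bernstein_szego_orthogonal[OF f]) simp
  qed (use B[of "p + 1"] B[of "p + 2"] f0 spectral_functional_add[OF f] spectral_functional_smult
        spectral_functional_pos[OF f] in auto)
  then obtain a0 b0 \<phi> c where H: "a0 0 = 1" "\<And>x. a0 x > 0" "\<phi> (p + 2) = ?B (p + 2)"
    "\<phi> (p + 1) = ?B (p + 1)" "a0 (p + 1) = 1" "\<phi> 0 = 0" "c > 0" "\<phi> 1 = [:c:]"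
    and degs: "\<forall>x\<in>{1..p+2}. degree (\<phi> x) = x - 1"
    and rec: "\<forall>x\<in>{1..p+1}. [:0, 1:] * \<phi> x =
       smult (a0 x) (\<phi> (x + 1)) + smult (b0 x) (\<phi> x) + smult (a0 (x - 1)) (\<phi> (x - 1))"
    by blast
  \<comment> \<open>comparing the recursion with the free recurrence at the same place, in degree p\<close>
  have b0: "b0 (p + 1) = 0"
  proof -
    have "?B (p + 2) + ?B p = smult (a0 (p + 1)) (?B (p + 2)) + smult (b0 (p + 1)) (?B (p + 1)) + smult (a0 p) (\<phi> p)"
      using bspec[OF rec, of "p + 1"] bernstein_szego_rec[of f p] H(3,4) by simp
    hence "?B p = smult (b0 (p + 1)) (?B (p + 1)) + smult (a0 p) (\<phi> p)" using H(5) by simp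
    hence "coeff (?B p) p = b0 (p + 1) * coeff (?B (p + 1)) p + a0 p * coeff (\<phi> p) p" by simp
    moreover have "coeff (?B p) p = 0"
      using bernstein_szego_degree_le[of f p] deg p by (intro coeff_eq_0) auto
    moreover have "coeff (\<phi> p) p = 0" using degs p by (intro coeff_eq_0) auto
    ultimately show ?thesis using B(2)[of "p + 1"] f0 by simp
  qed
  define a where "a x = (if x \<le> p then a0 x else 1)" for x
  define b where "b x = (if x \<le> p then b0 x else 0)" for x
  define \<Phi> where "\<Phi> x = (if x \<le> p then \<phi> x else ?B x)" for x
  have rec': "[:0, 1:] * \<Phi> x = smult (a x) (\<Phi> (x + 1)) + smult (b x) (\<Phi> x) + smult (a (x - 1)) (\<Phi> (x - 1))"
    if "x \<ge> 1" for x
  proof -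
    consider "x \<le> p" | "x = p + 1" | "x > p + 1" by linarith
    thus ?thesis
    proof cases
      case 1
      have "\<Phi> (x + 1) = \<phi> (x + 1)" using 1 H(4) by (cases "x = p") (auto simp: \<Phi>_def)
      thus ?thesis using 1 that bspec[OF rec, of x] by (auto simp: \<Phi>_def a_def b_def)
    next
      case 2
      thus ?thesis using bspec[OF rec, of x] H(3,4,5) b0 by (simp add: \<Phi>_def a_def b_def)
    next
      case 3
      then obtain m where "x = Suc m" "m > p" by (cases x) auto
      thus ?thesis using bernstein_szego_rec[of f m] by (simp add: \<Phi>_def a_def b_def)
    qed
  qed
  have a_pos: "a x > 0" for x using H(2) by (simp add: a_def)
  have fin: "\<forall>x>p. a x = 1 \<and> b x = 0" by (simp add: a_def b_def)
  have a0: "a 0 = 1" using H(1) by (simp add: a_def)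
  have "f = smult c (jost_factor a b p 0)"
  proof (rule real_poly_eqI[of 0 1])
    fix z :: real assume z: "0 < z" "z < 1"
    define u where "u = (\<lambda>x. z ^ x * poly (jost_factor a b p x) z)"
    define v where "v x = poly (\<Phi> x) (z + inverse z)" for x
    let ?w = "inverse z - z" and ?l = "z + inverse z"
    have w: "?w \<noteq> 0" using z by (metis less_asym one_less_inverse right_minus_eq)
    have z0: "z \<noteq> 0" using z by simp
    have u: "a x * u (x + 1) + b x * u x + a (x - 1) * u (x - 1) = ?l * u x" if "x \<ge> 1" for x
      using jost_solution_real[OF a_pos fin z0 that u_def] .
    have v: "a x * v (x + 1) + b x * v x + a (x - 1) * v (x - 1) = ?l * v x" if "x \<ge> 1" for x
      using arg_cong[OF rec'[OF that], of "\<lambda>q. poly q ?l"] by (simp add: v_def)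
    have v1: "v 1 = c" "v 0 = 0" using H(6,8) p by (simp_all add: v_def \<Phi>_def)
    have u0: "u 0 = poly (jost_factor a b p 0) z" by (simp add: u_def)
    have top: "u (p + 1) = z ^ (p + 1)" "u (p + 2) = z ^ (p + 2)"
      by (simp_all add: u_def jost_factor_beyond)
    have "0 = a (p + 1) * (u (p + 1 + 1) * v (p + 1) - u (p + 1) * v (p + 1 + 1)) - a 0 * (u 1 * v 0 - u 0 * v 1)"
      using christoffel_darboux[of a u b ?l v ?l "p + 1", OF u v] by simp
    hence "u 0 * c = z ^ (p + 1) * v (p + 2) - z ^ (p + 2) * v (p + 1)"
      using fin a0 v1 top by simp
    from arg_cong[OF this, of "\<lambda>t. ?w * t"]
    have "?w * (u 0 * c) = z ^ (p + 1) * (?w * v (p + 2)) - z ^ (p + 2) * (?w * v (p + 1))"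
      by (simp only: right_diff_distrib mult.left_commute)
    also have "\<dots> = z ^ (p + 1) * (poly f z * inverse z ^ (p + 2) - poly f (inverse z) * z ^ (p + 2))
       - z ^ (p + 2) * (poly f z * inverse z ^ (p + 1) - poly f (inverse z) * z ^ (p + 1))"
      unfolding v_def using bernstein_szego_eval_real[OF z0, of f] by (simp add: \<Phi>_def)
    also have "\<dots> = poly f z * ((z * inverse z) ^ (p + 1) * inverse z - (z * inverse z) ^ (p + 1) * z)"
      by (simp only: power_mult_distrib) (simp add: algebra_simps)
    also have "\<dots> = ?w * poly f z" using z0 by simp
    finally show "poly f z = poly (smult c (jost_factor a b p 0)) z" using w u0 by (simp add: mult.commute)
  qed simp
  thus thesis using that[of a b c] a0 a_pos fin H(7) by blast
qed

lemma finite_tail_range: "\<forall>x>n. h x = (d::real) \<Longrightarrow> bounded (h ` A)" for h :: "nat \<Rightarrow> real"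
proof (rule bounded_subset)
  show "bounded (insert d (h ` {..n}))" by (intro finite_imp_bounded) simp
  show "\<forall>x>n. h x = d \<Longrightarrow> h ` A \<subseteq> insert d (h ` {..n})" by (auto simp: not_le) (metis atMost_iff imageI not_le)
qed

text \<open>Degree and leading coefficient of f determine the support of the perturbation and its type, because
the leading coefficient of the Jost function vanishes or has a sign together with 1 - a_p or -b_p.\<close>

theorem jost_like_realizable:
  assumes p: "p \<ge> 1" and k: "k \<in> {2 * p - 1, 2 * p}" and par: "odd k \<longleftrightarrow> flips_pos c \<noteq> flips_neg c"
    and deg: "degree f = k" and f: "jost_like f S"
    and lead: "if flips_pos c then lead_coeff f < 0 else lead_coeff f > 0"
  obtains a b C where "C > 0" "jost_function a b p = smult (of_real C) (cpoly f)"
    "disc_roots a b p = of_real ` S"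
    "jacobi_class c k p (card {s\<in>S. s > 0}) (card {s\<in>S. s < 0}) a b"
proof -
  have "degree f \<le> 2 * p" using deg k by auto
  then obtain a b C where H: "a 0 = 1" "\<And>x. a x > 0" "\<forall>x>p. a x = 1 \<and> b x = 0" "C > 0"
    "f = smult C (jost_factor a b p 0)"
    by (rule jost_factor_realizes[OF p _ f]) blast
  let ?Q = "jost_factor a b p 0"
  have J: "jacobi_coeffs a b"
    unfolding jacobi_coeffs_def using H(1,2,3) finite_tail_range[of p a 1] finite_tail_range[of p b 0]
    by simp
  note ld = jost_factor_lead[OF p J H(3) k refl]
  have Qk: "coeff f i = C * coeff ?Q i" for i by (subst H(5)) simp
  have nz: "coeff f k \<noteq> 0" using lead deg by (auto split: if_splits)
  have ap: "a p = 1" if "k = 2 * p - 1"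
  proof -
    have "coeff f (2 * p) = 0" using that deg p by (intro coeff_eq_0) simp
    thus ?thesis using ld(4) Qk H(4) by simp
  qed
  have sg: "sgn (coeff f k) = sgn (coeff ?Q k)" using H(4) by (simp add: Qk sgn_mult)
  have type: "has_type c k p a b"
  proof (cases c)
    case A_below
    hence "k = 2 * p" using par k p by auto
    moreover have "sgn (1 - a p) = 1" using ld(2) calculation lead A_below sg deg by simp
    ultimately show ?thesis using A_below by (simp add: sgn_1_pos)
  next
    case A_above
    hence "k = 2 * p" using par k p by auto
    moreover have "sgn (1 - a p) = -1" using ld(2) calculation lead A_above sg deg by simp
    ultimately show ?thesis using A_above by (simp add: sgn_1_neg)
  next
    case B_pos
    hence "k = 2 * p - 1" using par k p by auto
    moreover have "sgn (b p) = 1" using ld(3) calculation ap lead B_pos sg deg by simp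
    ultimately show ?thesis using B_pos by (simp add: sgn_1_pos)
  next
    case B_neg
    hence "k = 2 * p - 1" using par k p by auto
    moreover have "sgn (b p) = -1" using ld(3) calculation ap lead B_neg sg deg by simp
    ultimately show ?thesis using B_neg by (simp add: sgn_1_neg)
  qed
  have tail2: "\<forall>x>2*p. perturbation a b x = 0"
    using H(3) by (auto simp: perturbation_def)
  have pert: "perturbation a b \<in> pert_space k"
    unfolding pert_space_def mem_Collect_eq
  proof (intro conjI allI impI)
    show "bounded (perturbation a b ` {1..})" by (rule finite_tail_range[OF tail2])
    show "perturbation a b (2 * x) > -1" for x using H(2)[of x] by (simp add: perturbation_def)
    show "perturbation a b k \<noteq> 0"
      using k type perturbation_top[OF p, of a b] by (cases c) auto
    fix x assume "x > k"
    hence "x > 2 * p \<or> (k = 2 * p - 1 \<and> x = 2 * p)" using k by auto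
    thus "perturbation a b x = 0" using tail2 ap perturbation_top[OF p, of a b] by auto
  qed
  have F: "jost_function a b p = cpoly ?Q" by (rule jost_function_eq_cpoly[OF J pert k])
  hence F': "jost_function a b p = smult (of_real (inverse C)) (cpoly f)"
    using H(4) by (subst H(5)) (simp add: cpoly_smult)
  have dr: "disc_roots a b p = of_real ` S"
  proof -
    have "poly (jost_function a b p) z = 0 \<longleftrightarrow> poly (cpoly f) z = 0" for z
      using H(4) by (simp add: F')
    thus ?thesis using f by (auto simp: disc_roots_def jost_like_def)
  qed
  have "{s::real. s > 0 \<and> of_real s \<in> disc_roots a b p} = {s\<in>S. s > 0}"
    "{s::real. s < 0 \<and> of_real s \<in> disc_roots a b p} = {s\<in>S. s < 0}"
    by (auto simp: dr image_iff)
  hence "jacobi_class c k p (card {s\<in>S. s > 0}) (card {s\<in>S. s < 0}) a b"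
    unfolding jacobi_class_def using J pert type by simp
  thus thesis using that[of "inverse C"] F' dr H(4) by simp
qed

section \<open>Polynomials with prescribed zeros\<close>

text \<open>The contribution of a further zero x to f'(s) f(1/s) at a zero s in (-1,1). For x of the same sign as s it
is negative exactly when |x| lies between |s| and 1/|s|, and for x of the opposite sign it is positive;
so the sign rule at s is a parity condition on the number of zeros in that range.\<close>

definition pair_factor :: "real \<Rightarrow> real \<Rightarrow> real" where
  "pair_factor s x = (1 - s / x) * (1 - inverse s / x)"

lemma pair_factor_pos:
  assumes "0 < s" "s < 1" "0 < x"
  shows "x < s \<or> inverse s < x \<Longrightarrow> pair_factor s x > 0"
    and "s < x \<Longrightarrow> x < inverse s \<Longrightarrow> pair_factor s x < 0"
proof -
  have eq: "pair_factor s x = (x - s) * (x - inverse s) / x\<^sup>2"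
    using assms by (simp add: pair_factor_def field_simps power2_eq_square)
  have "s < inverse s" using assms one_less_inverse[of s] by linarith
  thus "x < s \<or> inverse s < x \<Longrightarrow> pair_factor s x > 0"
    unfolding eq using assms by (intro divide_pos_pos) (auto simp: zero_less_mult_iff)
  show "s < x \<Longrightarrow> x < inverse s \<Longrightarrow> pair_factor s x < 0"
    unfolding eq using assms by (intro divide_neg_pos) (auto simp: mult_less_0_iff)
qed

lemma pair_factor_opposite: "s * x < 0 \<Longrightarrow> pair_factor s x > 0"
proof -
  assume "s * x < 0"
  hence "s / x < 0" "inverse s / x < 0" by (auto simp: mult_less_0_iff divide_less_0_iff)
  thus ?thesis unfolding pair_factor_def by (intro mult_pos_pos) linarith+
qed

lemma pair_factor_uminus: "pair_factor (- s) (- x) = pair_factor s x"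
  by (simp add: pair_factor_def)

text \<open>Every s in S receives an outer zero \<rho>(s) between 1/s and the reciprocal of its predecessor; the smallest
element is left without one if \<tau> holds. Seen from another s', the points s and \<rho>(s) are then both in
the critical range or both outside it, so that each pair contributes a positive factor.\<close>

lemma one_sided_zeros:
  assumes fin: "finite S" and S: "S \<subseteq> {0<..<1}"
  obtains R where "finite R" "R \<subseteq> {1<..}" "card (S \<union> R) = forced_zeros (card S) \<tau>"
    "\<And>s. s \<in> S \<Longrightarrow> (\<Prod>x\<in>S \<union> R - {s}. pair_factor s x) > 0"
    "\<And>s t. s \<in> S \<Longrightarrow> t \<in> S \<Longrightarrow> t < s \<Longrightarrow> \<forall>u\<in>S. u \<le> t \<or> s \<le> u \<Longrightarrow> \<exists>r\<in>R. inverse s < r \<and> r < inverse t"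
proof (cases "S = {}")
  case True
  thus thesis by (intro that[of "if \<tau> then {2} else {}"]) (auto simp: forced_zeros_def)
next
  case ne: False
  have "\<exists>\<rho>>inverse s. \<forall>t\<in>S. t < s \<longrightarrow> \<rho> < inverse t" if "s \<in> S" for s
  proof -
    \<comment> \<open>the value 1/s + 1 takes the place of infinity when s has no predecessor\<close>
    let ?m = "Min (insert (inverse s + 1) (inverse ` {t\<in>S. t < s}))"
    have "inverse s < ?m" using fin S that by (subst Min_gr_iff) force+
    then obtain \<rho> where "inverse s < \<rho>" "\<rho> < ?m" using dense by blast
    moreover have "?m \<le> inverse t" if "t \<in> S" "t < s" for t
      using that fin by (intro Min_le) auto
    ultimately show ?thesis by (meson less_le_trans)
  qed
  then obtain \<rho> where \<rho>: "\<And>s. s \<in> S \<Longrightarrow> inverse s < \<rho> s"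
    "\<And>s t. s \<in> S \<Longrightarrow> t \<in> S \<Longrightarrow> t < s \<Longrightarrow> \<rho> s < inverse t" by metis
  have \<rho>1: "\<rho> s > 1" if "s \<in> S" for s
    using \<rho>(1)[OF that] that S one_less_inverse[of s] by force
  have inj: "inj_on \<rho> S"
  proof (rule linorder_inj_onI)
    fix s t assume "s < t" "s \<in> S" "t \<in> S"
    thus "\<rho> s \<noteq> \<rho> t" using \<rho>(1)[of s] \<rho>(2)[of t s] by force
  qed auto
  define m where "m = Min S"
  have m: "m \<in> S" "\<And>s. s \<in> S \<Longrightarrow> m \<le> s" using fin ne by (auto simp: m_def)
  define T where "T = (if \<tau> then S - {m} else S)"
  have T: "T \<subseteq> S" "finite T" "inj_on \<rho> T" using fin inj by (auto simp: T_def intro: inj_on_subset)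
  have disj: "S \<inter> \<rho> ` T = {}" using \<rho>1 S T(1) by force
  show thesis
  proof (rule that[of "\<rho> ` T"])
    show "card (S \<union> \<rho> ` T) = forced_zeros (card S) \<tau>"
    proof -
      have "card (S \<union> \<rho> ` T) = card S + card T"
        using disj fin T by (simp add: card_Un_disjoint card_image)
      moreover have "card S > 0" using fin ne by (simp add: card_gt_0_iff)
      ultimately show ?thesis using m(1) fin by (auto simp: T_def forced_zeros_def)
    qed
    show "\<exists>r\<in>\<rho> ` T. inverse s < r \<and> r < inverse t" if "s \<in> S" "t \<in> S" "t < s" for s t
    proof -
      have "s \<in> T" using that m(2)[of t] by (auto simp: T_def)
      thus ?thesis using \<rho>(1)[of s] \<rho>(2)[of s t] that by auto
    qed
    show "(\<Prod>x\<in>S \<union> \<rho> ` T - {s}. pair_factor s x) > 0" if s: "s \<in> S" for s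
    proof -
      have s1: "0 < s" "s < 1" using s S by auto
      define g where "g t = (if t = s then 1 else pair_factor s t)" for t
      define h where "h t = (if t \<in> T then pair_factor s (\<rho> t) else 1)" for t
      have "S \<union> \<rho> ` T - {s} = (S - {s}) \<union> \<rho> ` T" using s disj by auto
      hence "(\<Prod>x\<in>S \<union> \<rho> ` T - {s}. pair_factor s x) =
          (\<Prod>x\<in>S - {s}. pair_factor s x) * (\<Prod>x\<in>\<rho> ` T. pair_factor s x)"
        using fin T(2) disj by (simp only:) (subst prod.union_disjoint, auto)
      also have "(\<Prod>x\<in>S - {s}. pair_factor s x) = (\<Prod>x\<in>S. g x)"
        using fin by (intro prod.mono_neutral_cong_left) (auto simp: g_def)
      also have "(\<Prod>x\<in>\<rho> ` T. pair_factor s x) = (\<Prod>x\<in>T. pair_factor s (\<rho> x))"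
        using T(3) by (simp add: prod.reindex)
      also have "\<dots> = (\<Prod>x\<in>S. h x)"
        using fin T by (intro prod.mono_neutral_cong_left) (auto simp: h_def)
      also have "(\<Prod>x\<in>S. g x) * (\<Prod>x\<in>S. h x) = (\<Prod>x\<in>S. g x * h x)" by (simp add: prod.distrib)
      also have "\<dots> > 0"
      proof (rule prod_pos)
        fix t assume t: "t \<in> S"
        have t1: "0 < t" "t < 1" "\<rho> t > 1" using t S \<rho>1 by auto
        consider "t = s" | "t < s" | "t > s" by linarith
        thus "g t * h t > 0"
        proof cases
          case 1
          thus ?thesis using \<rho>(1)[OF s] s1 t1 by (auto simp: g_def h_def intro: pair_factor_pos)
        next
          case 2
          have "inverse s < \<rho> t" using \<rho>(1)[OF t] 2 t1 by (meson less_imp_inverse_less less_trans)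
          thus ?thesis using 2 s1 t1 by (auto simp: g_def h_def intro!: mult_pos_pos pair_factor_pos)
        next
          case 3
          have "t \<in> T" using 3 t s m(2)[of s] by (auto simp: T_def)
          moreover have "pair_factor s t < 0" using 3 s1 t1 one_less_inverse[of s]
            by (intro pair_factor_pos) auto
          moreover have "pair_factor s (\<rho> t) < 0" using \<rho>(2)[OF t s 3] s1 t1
            by (intro pair_factor_pos) auto
          ultimately show ?thesis using 3 by (simp add: g_def h_def mult_neg_neg)
        qed
      qed
      finally show ?thesis .
    qed
  qed (use T \<rho>1 in auto)
qed

lemma odd_forced_zeros: "odd (forced_zeros n \<tau>) \<longleftrightarrow> \<tau>"
  by (auto simp: forced_zeros_def)

text \<open>The construction on each half-axis separately: the zeros on the opposite half-axis contribute only
positive factors to the sign rule.\<close>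

lemma two_sided_zeros:
  assumes fin: "finite S" and S: "\<And>s. s \<in> S \<Longrightarrow> s \<noteq> 0 \<and> \<bar>s\<bar> < 1"
  obtains R where "finite R" "\<And>r. r \<in> R \<Longrightarrow> \<bar>r\<bar> > 1"
    "card (S \<union> R) = forced_zeros (card {s\<in>S. s > 0}) \<tau> + forced_zeros (card {s\<in>S. s < 0}) \<tau>'"
    "odd (card {x\<in>S \<union> R. x > 0}) \<longleftrightarrow> \<tau>"
    "\<And>s. s \<in> S \<Longrightarrow> (\<Prod>x\<in>S \<union> R - {s}. pair_factor s x) > 0"
    "\<And>s t. s \<in> S \<Longrightarrow> t \<in> S \<Longrightarrow> t < s \<Longrightarrow> s * t > 0 \<Longrightarrow> \<forall>u\<in>S. u \<le> t \<or> s \<le> u \<Longrightarrow>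
      \<exists>r\<in>R. inverse s < r \<and> r < inverse t"
proof -
  define P where "P = {s\<in>S. s > 0}"
  define N where "N = {s\<in>S. s < 0}"
  have "s > 0 \<or> s < 0" if "s \<in> S" for s using S[OF that] by linarith
  hence PN: "S = P \<union> N" "finite P" "finite N" "finite (uminus ` N)" using fin by (auto simp: P_def N_def)
  have P: "P \<subseteq> {0<..<1}" using S by (force simp: P_def)
  have N: "uminus ` N \<subseteq> {0<..<1}" using S by (force simp: N_def)
  obtain A where A: "finite A" "A \<subseteq> {1<..}" "card (P \<union> A) = forced_zeros (card P) \<tau>"
    "\<And>s. s \<in> P \<Longrightarrow> (\<Prod>x\<in>P \<union> A - {s}. pair_factor s x) > 0"
    "\<And>s t. s \<in> P \<Longrightarrow> t \<in> P \<Longrightarrow> t < s \<Longrightarrow> \<forall>u\<in>P. u \<le> t \<or> s \<le> u \<Longrightarrow> \<exists>r\<in>A. inverse s < r \<and> r < inverse t"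
    using one_sided_zeros[OF PN(2) P, of \<tau>] by metis
  obtain B where B: "finite B" "B \<subseteq> {1<..}" "card (uminus ` N \<union> B) = forced_zeros (card (uminus ` N)) \<tau>'"
    "\<And>s. s \<in> uminus ` N \<Longrightarrow> (\<Prod>x\<in>uminus ` N \<union> B - {s}. pair_factor s x) > 0"
    "\<And>s t. s \<in> uminus ` N \<Longrightarrow> t \<in> uminus ` N \<Longrightarrow> t < s \<Longrightarrow> \<forall>u\<in>uminus ` N. u \<le> t \<or> s \<le> u \<Longrightarrow>
      \<exists>r\<in>B. inverse s < r \<and> r < inverse t"
    using one_sided_zeros[OF PN(4) N, of \<tau>'] by metis
  define R where "R = A \<union> uminus ` B"
  have split: "S \<union> R = (P \<union> A) \<union> uminus ` (uminus ` N \<union> B)"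
    by (auto simp: PN(1) R_def image_image image_Un)
  have pos: "x > 0" if "x \<in> P \<union> A" for x using that A(2) by (force simp: P_def)
  have neg: "x < 0" if "x \<in> uminus ` (uminus ` N \<union> B)" for x using that B(2) by (force simp: N_def)
  have disj: "(P \<union> A) \<inter> uminus ` (uminus ` N \<union> B) = {}" using pos neg by (meson disjoint_iff less_asym)
  have finA: "finite (P \<union> A)" and finB: "finite (uminus ` N \<union> B)" using PN A(1) B(1) by auto
  show thesis
  proof (rule that[of R])
    show "finite R" using A(1) B(1) by (simp add: R_def)
    show "\<bar>r\<bar> > 1" if "r \<in> R" for r using that A(2) B(2) by (force simp: R_def)
    show "card (S \<union> R) = forced_zeros (card {s\<in>S. s > 0}) \<tau> + forced_zeros (card {s\<in>S. s < 0}) \<tau>'"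
      unfolding split P_def[symmetric] N_def[symmetric]
      using disj finA finB A(3) B(3) by (subst card_Un_disjoint) (auto simp: card_image)
    have "{x\<in>S \<union> R. x > 0} = P \<union> A" unfolding split using pos neg by (auto dest: less_asym)
    thus "odd (card {x\<in>S \<union> R. x > 0}) \<longleftrightarrow> \<tau>" by (simp add: A(3) odd_forced_zeros)
    show "(\<Prod>x\<in>S \<union> R - {s}. pair_factor s x) > 0" if s: "s \<in> S" for s
    proof (cases "s > 0")
      case True
      hence sP: "s \<in> P" using s by (simp add: P_def)
      have "S \<union> R - {s} = (P \<union> A - {s}) \<union> uminus ` (uminus ` N \<union> B)"
        unfolding split using disj sP by auto
      hence "(\<Prod>x\<in>S \<union> R - {s}. pair_factor s x) =
          (\<Prod>x\<in>P \<union> A - {s}. pair_factor s x) * (\<Prod>x\<in>uminus ` (uminus ` N \<union> B). pair_factor s x)"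
        using finA finB disj by (simp only:) (subst prod.union_disjoint, auto)
      also have "\<dots> > 0"
        using neg True by (intro mult_pos_pos A(4)[OF sP] prod_pos pair_factor_opposite mult_pos_neg)
      finally show ?thesis .
    next
      case False
      hence s0: "s < 0" using S[OF s] by simp
      hence sN: "s \<in> N" using s by (simp add: N_def)
      have "S \<union> R - {s} = (P \<union> A) \<union> uminus ` (uminus ` N \<union> B - {- s})"
        unfolding split using pos[of s] s0 sN by (auto simp: image_iff)
      hence "(\<Prod>x\<in>S \<union> R - {s}. pair_factor s x) =
          (\<Prod>x\<in>P \<union> A. pair_factor s x) * (\<Prod>x\<in>uminus ` (uminus ` N \<union> B - {- s}). pair_factor s x)"
        using finA finB disj by (simp only:) (subst prod.union_disjoint, auto)
      also have "(\<Prod>x\<in>uminus ` (uminus ` N \<union> B - {- s}). pair_factor s x) =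
          (\<Prod>x\<in>uminus ` N \<union> B - {- s}. pair_factor (- s) x)"
        by (subst prod.reindex) (auto simp: pair_factor_uminus[of "- s", simplified])
      also have "(\<Prod>x\<in>P \<union> A. pair_factor s x) * \<dots> > 0"
        using pos s0 sN by (intro mult_pos_pos B(4) prod_pos pair_factor_opposite mult_neg_pos) auto
      finally show ?thesis .
    qed
    show "\<exists>r\<in>R. inverse s < r \<and> r < inverse t"
      if st: "s \<in> S" "t \<in> S" "t < s" "s * t > 0" "\<forall>u\<in>S. u \<le> t \<or> s \<le> u" for s t
    proof (cases "s > 0")
      case True
      hence "t > 0" using st(4) by (simp add: zero_less_mult_iff)
      hence "\<exists>r\<in>A. inverse s < r \<and> r < inverse t"
        using True st by (intro A(5)) (auto simp: P_def)
      thus ?thesis by (auto simp: R_def)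
    next
      case False
      hence "s < 0" "t < 0" using st(4) by (auto simp: zero_less_mult_iff)
      hence "\<exists>r\<in>B. inverse (- t) < r \<and> r < inverse (- s)"
        using st by (intro B(5)) (auto simp: N_def)
      thus ?thesis by (force simp: R_def)
    qed
  qed
qed

text \<open>Normalised to have the value 1 at 0.\<close>

definition zero_poly :: "real set \<Rightarrow> real poly" where
  "zero_poly Z = (\<Prod>x\<in>Z. [:1, - inverse x:])"

lemma poly_zero_poly: "poly (zero_poly Z) y = (\<Prod>x\<in>Z. 1 - y / x)"
  by (simp add: zero_poly_def poly_prod divide_inverse)

lemma zero_poly_remove: "finite Z \<Longrightarrow> s \<in> Z \<Longrightarrow> zero_poly Z = [:1, - inverse s:] * zero_poly (Z - {s})"
  unfolding zero_poly_def by (rule prod.remove)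

lemma zero_poly_lead:
  assumes "finite Z" "0 \<notin> Z"
  shows "degree (zero_poly Z) = card Z"
    and "if odd (card {x\<in>Z. x > 0}) then lead_coeff (zero_poly Z) < 0 else lead_coeff (zero_poly Z) > 0"
proof -
  have "degree (zero_poly Z) = card Z \<and>
    (if odd (card {x\<in>Z. x > 0}) then lead_coeff (zero_poly Z) < 0 else lead_coeff (zero_poly Z) > 0)"
    using assms
  proof (induction Z rule: finite_induct)
    case empty
    thus ?case by (simp add: zero_poly_def)
  next
    case (insert x Z)
    have eq: "zero_poly (insert x Z) = [:1, - inverse x:] * zero_poly Z"
      using insert by (simp add: zero_poly_def)
    have IH: "degree (zero_poly Z) = card Z"
      "if odd (card {x\<in>Z. x > 0}) then lead_coeff (zero_poly Z) < 0 else lead_coeff (zero_poly Z) > 0"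
      using insert by auto
    have x: "x \<noteq> 0" using insert.prems by auto
    have nz: "zero_poly Z \<noteq> 0" using IH(2) by (auto split: if_splits)
    have deg: "degree (zero_poly (insert x Z)) = card (insert x Z)"
      unfolding eq using insert x nz IH(1) by (subst degree_mult_eq) auto
    have lc: "lead_coeff (zero_poly (insert x Z)) = - inverse x * lead_coeff (zero_poly Z)"
      unfolding eq lead_coeff_mult using x by simp
    have "{y\<in>insert x Z. y > 0} = (if x > 0 then insert x {y\<in>Z. y > 0} else {y\<in>Z. y > 0})" by auto
    hence "card {y\<in>insert x Z. y > 0} = (if x > 0 then Suc (card {y\<in>Z. y > 0}) else card {y\<in>Z. y > 0})"
      using insert by auto
    thus ?case using deg IH(2) x unfolding lc
      by (auto simp: mult_less_0_iff zero_less_mult_iff not_less)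
  qed
  thus "degree (zero_poly Z) = card Z"
    "if odd (card {x\<in>Z. x > 0}) then lead_coeff (zero_poly Z) < 0 else lead_coeff (zero_poly Z) > 0"
    by blast+
qed

lemma cpoly_zero_poly_root:
  assumes "finite Z" "0 \<notin> Z"
  shows "poly (cpoly (zero_poly Z)) z = 0 \<longleftrightarrow> z \<in> of_real ` Z"
proof -
  have "1 - z * inverse (of_real x) = 0 \<longleftrightarrow> z = of_real x" if "x \<in> Z" for x
    using that assms by (auto simp: field_simps)
  thus ?thesis using assms
    by (auto simp: zero_poly_def cpoly_prod poly_prod map_poly_pCons of_real_inverse)
qed

text \<open>With f = h \<Prod>(1 - z/x), the derivative at a zero s involves only the remaining factors, so that
s f'(s) f(1/s) is the product of 1/s^2 - 1, of the pair factors and of h(s) h(1/s).\<close>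

lemma realization:
  assumes p: "p \<ge> 1" and k: "k \<in> {2 * p - 1, 2 * p}" and par: "odd k \<longleftrightarrow> flips_pos c \<noteq> flips_neg c"
    and fin: "finite S" "finite R" and S: "\<And>s. s \<in> S \<Longrightarrow> s \<noteq> 0 \<and> \<bar>s\<bar> < 1"
    and R: "\<And>r. r \<in> R \<Longrightarrow> \<bar>r\<bar> > 1"
    and flip: "odd (card {x\<in>S \<union> R. x > 0}) \<longleftrightarrow> flips_pos c"
    and sign: "\<And>s. s \<in> S \<Longrightarrow> (\<Prod>x\<in>S \<union> R - {s}. pair_factor s x) > 0"
    and deg: "degree h + card (S \<union> R) = k" and lead: "lead_coeff h > 0" and h0: "poly h 0 > 0"
    and hs: "\<And>s. s \<in> S \<Longrightarrow> poly h s * poly h (inverse s) > 0"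
    and hz: "\<And>z. norm z \<le> 1 \<Longrightarrow> poly (cpoly h) z \<noteq> 0"
  obtains a b C where "C > 0" "jost_function a b p = smult (of_real C) (cpoly (zero_poly (S \<union> R) * h))"
    "disc_roots a b p = of_real ` S"
    "jacobi_class c k p (card {s\<in>S. s > 0}) (card {s\<in>S. s < 0}) a b"
proof -
  let ?Z = "S \<union> R"
  define f where "f = zero_poly ?Z * h"
  have finZ: "finite ?Z" and Z0: "0 \<notin> ?Z" using fin S R by force+
  note zl = zero_poly_lead[OF finZ Z0]
  have h_nz: "h \<noteq> 0" using h0 by auto
  have z_nz: "zero_poly ?Z \<noteq> 0" using zl(2) by (auto split: if_splits)
  have like: "jost_like f S"
    unfolding jost_like_def
  proof (intro conjI allI impI ballI)
    show "finite S" by fact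
    show "poly f 0 > 0" using h0 by (simp add: f_def poly_zero_poly)
    show "poly (cpoly f) z = 0 \<longleftrightarrow> z \<in> of_real ` S" if "norm z \<le> 1" for z
    proof -
      have "z \<notin> of_real ` R" using that R by force
      thus ?thesis using hz[OF that] by (simp add: f_def cpoly_mult cpoly_zero_poly_root[OF finZ Z0] image_Un)
    qed
    fix s assume s: "s \<in> S"
    show "\<bar>s\<bar> < 1" using S[OF s] by simp
    have s0: "s \<noteq> 0" using S[OF s] by simp
    let ?Q = "zero_poly (?Z - {s})"
    have eq: "f = [:1, - inverse s:] * (?Q * h)"
      unfolding f_def mult.assoc[symmetric]
      by (rule arg_cong[of _ _ "\<lambda>q. q * h"], rule zero_poly_remove[OF finZ]) (use s in simp)
    have d: "s * poly (pderiv f) s = - (poly ?Q s * poly h s)"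
    proof -
      have "s * poly (pderiv ([:1, - inverse s:] * g)) s = - poly g s" for g
        using s0 unfolding pderiv_mult by (simp add: pderiv_pCons field_simps)
      thus ?thesis unfolding eq by simp
    qed
    have e: "poly f (inverse s) = (1 - inverse s * inverse s) * (poly ?Q (inverse s) * poly h (inverse s))"
      unfolding eq by (simp add: algebra_simps)
    have Q: "poly ?Q s * poly ?Q (inverse s) > 0"
      using sign[OF s] by (simp add: poly_zero_poly pair_factor_def flip: prod.distrib)
    have D: "inverse s * inverse s - 1 > 0"
    proof -
      have "s * s < 1" using S[OF s] by (metis abs_square_less_1 power2_eq_square)
      moreover have "s * s > 0" using s0 by (auto simp: zero_less_mult_iff)
      ultimately have "inverse (s * s) > 1" by (intro one_less_inverse)
      thus ?thesis by simp
    qed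
    have "0 < (inverse s * inverse s - 1) * ((poly ?Q s * poly ?Q (inverse s)) * (poly h s * poly h (inverse s)))"
      by (rule mult_pos_pos[OF D mult_pos_pos[OF Q hs[OF s]]])
    also have "(inverse s * inverse s - 1) * ((poly ?Q s * poly ?Q (inverse s)) * (poly h s * poly h (inverse s)))
       = s * poly (pderiv f) s * poly f (inverse s)"
      unfolding d e by (simp add: algebra_simps)
    finally show "s * poly (pderiv f) s * poly f (inverse s) > 0" .
  qed
  have df: "degree f = k" using deg zl(1) h_nz z_nz by (simp add: f_def degree_mult_eq)
  have lf: "if flips_pos c then lead_coeff f < 0 else lead_coeff f > 0"
    using zl(2) flip lead by (auto simp: f_def lead_coeff_mult mult_neg_pos split: if_splits)
  obtain a b C where "C > 0" "jost_function a b p = smult (of_real C) (cpoly f)"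
    "disc_roots a b p = of_real ` S"
    "jacobi_class c k p (card {s\<in>S. s > 0}) (card {s\<in>S. s < 0}) a b"
    by (rule jost_like_realizable[OF p k par df like lf])
  thus thesis unfolding f_def by (rule that)
qed

section \<open>Operators of extremal multiplicity\<close>

lemma int_forced_zeros: "int (forced_zeros n \<tau>) = (if \<tau> then 2 * max (int n) 1 - 1 else 2 * int n)"
  by (simp add: forced_zeros_def max_def of_nat_diff)

text \<open>Both k and the number of forced zeros have the parity of the number of sign changes between 0 and
plus or minus infinity.\<close>

lemma even_excess:
  assumes "odd k \<longleftrightarrow> flips_pos c \<noteq> flips_neg c" "forced_total c np nm \<le> k"
  shows "\<exists>e. k = forced_total c np nm + 2 * e"
proof -
  have "odd (forced_total c np nm) \<longleftrightarrow> flips_pos c \<noteq> flips_neg c"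
    using odd_forced_zeros[of np "flips_pos c"] odd_forced_zeros[of nm "flips_neg c"]
    by (auto simp: forced_total_def)
  hence "even k \<longleftrightarrow> even (forced_total c np nm)" using assms(1) by blast
  hence "even (k - forced_total c np nm)" using assms(2) by simp
  then obtain e where "k - forced_total c np nm = 2 * e" by (rule evenE)
  thus ?thesis using assms(2) by (intro exI[of _ e]) simp
qed

lemma has_type_index:
  "p \<ge> 1 \<Longrightarrow> has_type c k p a b \<Longrightarrow>
    int k = 2 * int p - (if flips_pos c \<noteq> flips_neg c then 1 else 0)"
  by (cases c) auto

lemma M_nonreal_eq:
  assumes "p \<ge> 1" "has_type c k p a b"
  shows "int k - int (forced_total c np nm) = 2 * M_nonreal c (int p) (int np) (int nm)"
  unfolding has_type_index[OF assms] forced_total_def of_nat_add int_forced_zeros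
  by (cases c) simp_all

text \<open>The formula for M in the real case is the excess of k over the number of forced zeros, plus one; only without zeros in the disc, and with no
sign change at infinity, is it capped at 2p.\<close>

lemma M_real_eq:
  assumes "p \<ge> 1" "has_type c k p a b"
  shows "min (M_real c (int p) (int np) (int nm)) (int k - (int np + int nm)) =
      min (int k - int (forced_total c np nm) + 1) (int k - (int np + int nm))"
    and "np + nm \<ge> 1 \<Longrightarrow> M_real c (int p) (int np) (int nm) = int k - int (forced_total c np nm) + 1"
  unfolding has_type_index[OF assms] forced_total_def of_nat_add int_forced_zeros
  by (cases c; simp)+

text \<open>A choice R of outer zeros that, together with S, attains the forced number of zeros and satisfies the
sign rule for the type c.\<close>

definition balanced_zeros :: "pert_type \<Rightarrow> real set \<Rightarrow> real set \<Rightarrow> bool" where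
  "balanced_zeros c S R \<longleftrightarrow> finite R \<and> (\<forall>r\<in>R. \<bar>r\<bar> > 1) \<and>
     card (S \<union> R) = forced_total c (card {s\<in>S. s > 0}) (card {s\<in>S. s < 0}) \<and>
     (odd (card {x\<in>S \<union> R. x > 0}) \<longleftrightarrow> flips_pos c) \<and>
     (\<forall>s\<in>S. (\<Prod>x\<in>S \<union> R - {s}. pair_factor s x) > 0)"

lemma balanced_zeros_exist:
  assumes "finite S" "\<And>s. s \<in> S \<Longrightarrow> s \<noteq> 0 \<and> \<bar>s\<bar> < 1"
  obtains R where "balanced_zeros c S R"
    "\<And>s t. s \<in> S \<Longrightarrow> t \<in> S \<Longrightarrow> t < s \<Longrightarrow> s * t > 0 \<Longrightarrow> \<forall>u\<in>S. u \<le> t \<or> s \<le> u \<Longrightarrow>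
      \<exists>r\<in>R. inverse s < r \<and> r < inverse t"
proof (rule two_sided_zeros[OF assms, of "flips_pos c" "flips_neg c"])
  fix R
  assume R: "finite R" "\<And>r. r \<in> R \<Longrightarrow> \<bar>r\<bar> > 1"
    "card (S \<union> R) = forced_zeros (card {s\<in>S. s > 0}) (flips_pos c)
      + forced_zeros (card {s\<in>S. s < 0}) (flips_neg c)"
    "odd (card {x\<in>S \<union> R. x > 0}) \<longleftrightarrow> flips_pos c"
    "\<And>s. s \<in> S \<Longrightarrow> (\<Prod>x\<in>S \<union> R - {s}. pair_factor s x) > 0"
    and between: "\<And>s t. s \<in> S \<Longrightarrow> t \<in> S \<Longrightarrow> t < s \<Longrightarrow> s * t > 0 \<Longrightarrow> \<forall>u\<in>S. u \<le> t \<or> s \<le> u \<Longrightarrow>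
      \<exists>r\<in>R. inverse s < r \<and> r < inverse t"
  have "balanced_zeros c S R"
    unfolding balanced_zeros_def forced_total_def using R by blast
  thus thesis using between by (rule that)
qed

lemma order_zero_poly:
  assumes "finite Z" "0 \<notin> Z"
  shows "order z (cpoly (zero_poly Z)) = (if z \<in> of_real ` Z then 1 else 0)"
proof (cases "z \<in> of_real ` Z")
  case True
  then obtain t where t: "t \<in> Z" "z = of_real t" by auto
  hence t0: "t \<noteq> 0" using assms by auto
  let ?Q = "cpoly (zero_poly (Z - {t}))"
  have "poly ?Q z \<noteq> 0" using assms t by (subst cpoly_zero_poly_root) auto
  hence Q: "order z ?Q = 0" "?Q \<noteq> 0" by (auto simp: order_0I)
  have "cpoly [:1, - inverse t:] = smult (- inverse z) ([:- z, 1:] ^ 1)"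
    using t t0 by (simp add: map_poly_pCons of_real_inverse)
  moreover have "order z (smult (- inverse z) ([:- z, 1:] ^ 1)) = 1"
    using t t0 order_power_n_n[of z 1] by (subst order_smult) auto
  ultimately have "order z (cpoly [:1, - inverse t:]) = 1" by (simp only:)
  moreover have "cpoly [:1, - inverse t:] \<noteq> 0" by (simp add: cpoly_eq_0_iff)
  ultimately have lin: "order z (cpoly [:1, - inverse t:]) = 1" "cpoly [:1, - inverse t:] \<noteq> 0" by blast+
  have "order z (cpoly (zero_poly Z)) = order z (cpoly [:1, - inverse t:]) + order z ?Q"
    unfolding zero_poly_remove[OF assms(1) t(1)] cpoly_mult using lin(2) Q(2)
    by (intro order_mult) (simp only: mult_eq_0_iff, simp)
  thus ?thesis using True Q lin by (simp only:) simp
next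
  case False
  thus ?thesis using cpoly_zero_poly_root[OF assms] by (simp add: order_0I)
qed

lemma realization_order:
  assumes p: "p \<ge> 1" and k: "k \<in> {2 * p - 1, 2 * p}" and par: "odd k \<longleftrightarrow> flips_pos c \<noteq> flips_neg c"
    and fin: "finite S" and S: "\<And>s. s \<in> S \<Longrightarrow> s \<noteq> 0 \<and> \<bar>s\<bar> < 1" and R: "balanced_zeros c S R"
    and deg: "degree h + card (S \<union> R) = k" and lead: "lead_coeff h > 0" and h0: "poly h 0 > 0"
    and hs: "\<And>s. s \<in> S \<Longrightarrow> poly h s * poly h (inverse s) > 0"
    and hz: "\<And>z. norm z \<le> 1 \<Longrightarrow> poly (cpoly h) z \<noteq> 0"
  obtains a b where "jacobi_class c k p (card {s\<in>S. s > 0}) (card {s\<in>S. s < 0}) a b"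
    "disc_roots a b p = of_real ` S"
    "\<And>z. order z (jost_function a b p) =
       (if z \<in> of_real ` (S \<union> R) then 1 else 0) + order z (cpoly h)"
proof -
  have R': "finite R" "\<And>r. r \<in> R \<Longrightarrow> \<bar>r\<bar> > 1" using R by (auto simp: balanced_zeros_def)
  obtain a b C where H: "C > 0"
    "jost_function a b p = smult (of_real C) (cpoly (zero_poly (S \<union> R) * h))"
    "disc_roots a b p = of_real ` S"
    "jacobi_class c k p (card {s\<in>S. s > 0}) (card {s\<in>S. s < 0}) a b"
    by (rule realization[OF p k par fin R'(1) S R'(2) _ _ deg lead h0 hs hz])
      (use R in \<open>auto simp: balanced_zeros_def\<close>)
  have Z: "finite (S \<union> R)" "0 \<notin> S \<union> R" using fin S R' by force+
  have "zero_poly (S \<union> R) \<noteq> 0" using zero_poly_lead(2)[OF Z] by (auto split: if_splits)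
  moreover have "h \<noteq> 0" using h0 by auto
  ultimately have "order z (jost_function a b p) =
       (if z \<in> of_real ` (S \<union> R) then 1 else 0) + order z (cpoly h)" for z
    unfolding H(2) using H(1) order_zero_poly[OF Z]
    by (simp add: order_smult cpoly_mult order_mult cpoly_eq_0_iff)
  thus thesis using that H(3,4) by blast
qed

text \<open>The excess degree 2e is spent on the e-th power of the quadratic with zeros w and its conjugate,
which is positive on the real axis and therefore does not disturb the sign rule.\<close>

lemma nonreal_resonance_attained:
  assumes p: "p \<ge> 1" and k: "k \<in> {2 * p - 1, 2 * p}" and par: "odd k \<longleftrightarrow> flips_pos c \<noteq> flips_neg c"
    and fin: "finite S" and S: "\<And>s. s \<in> S \<Longrightarrow> s \<noteq> 0 \<and> \<bar>s\<bar> < 1" and R: "balanced_zeros c S R"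
    and e: "card (S \<union> R) + 2 * e = k" and w: "w \<notin> \<real>" "norm w > 1"
  obtains a b where "jacobi_class c k p (card {s\<in>S. s > 0}) (card {s\<in>S. s < 0}) a b"
    "order w (jost_function a b p) = e"
proof -
  define q where "q = [:(cmod w)\<^sup>2, - 2 * Re w, 1:]"
  have fact: "cpoly q = [:- w, 1:] * [:- cnj w, 1:]"
  proof -
    have "w * cnj w = of_real ((cmod w)\<^sup>2)" by (rule complex_norm_square[symmetric])
    moreover have "w + cnj w = of_real (2 * Re w)" by (simp add: complex_add_cnj)
    ultimately show ?thesis by (simp add: q_def map_poly_pCons algebra_simps)
  qed
  have qz: "poly (cpoly q) z = (z - w) * (z - cnj w)" for z
    by (simp add: fact algebra_simps)
  have qpos: "poly q x > 0" for x
  proof -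
    have "of_real (poly q x) = (of_real x - w) * cnj (of_real x - w)"
      by (simp add: qz flip: poly_cpoly_of_real)
    also have "\<dots> = of_real ((cmod (of_real x - w))\<^sup>2)" by (rule complex_norm_square[symmetric])
    finally have "poly q x = (cmod (of_real x - w))\<^sup>2" by (simp only: of_real_eq_iff)
    moreover have "of_real x - w \<noteq> 0" using w(1) by (metis Reals_of_real right_minus_eq)
    ultimately show ?thesis by simp
  qed
  have deg: "degree (q ^ e) = 2 * e" by (simp add: q_def degree_power_eq)
  have cne: "w \<noteq> cnj w" using w(1) by (metis Reals_cnj_iff)
  show thesis
  proof (rule realization_order[OF p k par fin S R, of "q ^ e"])
    show "degree (q ^ e) + card (S \<union> R) = k" using deg e by simp
    show "lead_coeff (q ^ e) > 0" by (simp add: lead_coeff_power q_def)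
    show "poly (q ^ e) 0 > 0" "\<And>s. poly (q ^ e) s * poly (q ^ e) (inverse s) > 0"
      using qpos by (simp_all add: poly_power)
    show "poly (cpoly (q ^ e)) z \<noteq> 0" if "norm z \<le> 1" for z
    proof -
      have "z \<noteq> w" "z \<noteq> cnj w" using that w(2) by auto
      thus ?thesis by (simp add: cpoly_power poly_power qz)
    qed
  next
    fix a b assume H: "jacobi_class c k p (card {s\<in>S. s > 0}) (card {s\<in>S. s < 0}) a b"
      "\<And>z. order z (jost_function a b p) =
         (if z \<in> of_real ` (S \<union> R) then 1 else 0) + order z (cpoly (q ^ e))"
    have "w \<notin> of_real ` (S \<union> R)" using w(1) by auto
    hence "order w (jost_function a b p) = order w (cpoly (q ^ e))" by (simp add: H(2))
    also have "\<dots> = order w ([:- w, 1:] ^ e * [:- cnj w, 1:] ^ e)"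
      by (simp only: cpoly_power fact power_mult_distrib)
    also have "\<dots> = order w ([:- w, 1:] ^ e) + order w ([:- cnj w, 1:] ^ e)"
      by (intro order_mult) simp
    also have "order w ([:- cnj w, 1:] ^ e) = 0" using cne by (intro order_0I) (simp add: poly_power)
    finally show thesis using that[OF H(1)] by (simp add: order_power_n_n)
  qed
qed

text \<open>The excess degree 2e is spent on an even power of z - t, which is positive away from t. If t is one of
the forced zeros, this raises its multiplicity to 2e + 1.\<close>

lemma real_resonance_attained:
  assumes p: "p \<ge> 1" and k: "k \<in> {2 * p - 1, 2 * p}" and par: "odd k \<longleftrightarrow> flips_pos c \<noteq> flips_neg c"
    and fin: "finite S" and S: "\<And>s. s \<in> S \<Longrightarrow> s \<noteq> 0 \<and> \<bar>s\<bar> < 1" and R: "balanced_zeros c S R"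
    and e: "card (S \<union> R) + 2 * e = k" and t: "\<bar>t\<bar> > 1" "t \<in> R \<or> t \<notin> inverse ` S"
  obtains a b where "jacobi_class c k p (card {s\<in>S. s > 0}) (card {s\<in>S. s < 0}) a b"
    "disc_roots a b p = of_real ` S"
    "order (of_real t) (jost_function a b p) = 2 * e + (if t \<in> R then 1 else 0)"
proof -
  have tS: "t \<notin> S" using S t(1) by force
  have ti: "t \<notin> inverse ` S"
  proof (rule ccontr)
    assume "\<not> t \<notin> inverse ` S"
    then obtain s where s: "s \<in> S" "t = inverse s" by auto
    hence "t \<in> S \<union> R - {s}" using t tS by auto
    moreover have "pair_factor s t = 0" using s S[of s] by (simp add: pair_factor_def)
    moreover have "finite (S \<union> R - {s})" using fin R by (simp add: balanced_zeros_def)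
    ultimately have "(\<Prod>x\<in>S \<union> R - {s}. pair_factor s x) = 0" by (intro prod_zero) auto
    thus False using R s(1) by (force simp: balanced_zeros_def)
  qed
  let ?h = "[:- t, 1:] ^ (2 * e)"
  have ev: "poly ?h x > 0" if "x \<noteq> t" for x
    using that by (simp add: poly_power power_mult)
  have ch: "cpoly ?h = [:- of_real t, 1:] ^ (2 * e)" by (simp add: cpoly_power map_poly_pCons)
  show thesis
  proof (rule realization_order[OF p k par fin S R, of ?h])
    show "degree ?h + card (S \<union> R) = k" using e by (simp add: degree_linear_power)
    show "lead_coeff ?h > 0" by (simp add: lead_coeff_power)
    show "poly ?h 0 > 0" using t(1) by (intro ev) auto
    show "poly ?h s * poly ?h (inverse s) > 0" if "s \<in> S" for s
      using tS ti that by (intro mult_pos_pos ev) auto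
    show "poly (cpoly ?h) z \<noteq> 0" if "norm z \<le> 1" for z
      using that t(1) by (auto simp: ch poly_power)
  next
    fix a b assume H: "jacobi_class c k p (card {s\<in>S. s > 0}) (card {s\<in>S. s < 0}) a b"
      "disc_roots a b p = of_real ` S"
      "\<And>z. order z (jost_function a b p) =
         (if z \<in> of_real ` (S \<union> R) then 1 else 0) + order z (cpoly ?h)"
    have "complex_of_real t \<in> of_real ` (S \<union> R) \<longleftrightarrow> t \<in> R" using tS by auto
    thus thesis using that[OF H(1,2)] by (simp add: H(3) ch order_power_n_n)
  qed
qed

lemma real_disc_roots:
  assumes "p \<ge> 1" and cl: "jacobi_class c k p np nm a b"
  defines "S \<equiv> {s :: real. of_real s \<in> disc_roots a b p}"
  shows "finite S" "\<And>s. s \<in> S \<Longrightarrow> s \<noteq> 0 \<and> \<bar>s\<bar> < 1"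
    "np = card {s\<in>S. s > 0}" "nm = card {s\<in>S. s < 0}"
proof -
  obtain f where f: "jost_function a b p = cpoly f" "poly f 0 > 0"
    by (rule jost_polynomial_of_class[OF assms(1) cl]) blast
  have S: "s \<in> S \<longleftrightarrow> \<bar>s\<bar> < 1 \<and> poly f s = 0" for s
    by (simp add: S_def disc_roots_def f(1) poly_cpoly_of_real)
  show "finite S" using f(2) by (intro finite_subset[OF _ poly_roots_finite[of f]]) (auto simp: S)
  show "s \<noteq> 0 \<and> \<bar>s\<bar> < 1" if "s \<in> S" for s using that f(2) by (auto simp: S)
  show "np = card {s\<in>S. s > 0}" "nm = card {s\<in>S. s < 0}"
    using cl by (auto simp: jacobi_class_def S_def conj_commute)
qed

lemma resonance_of_order:
  assumes "p \<ge> 1" "jacobi_class c k p np nm a b" "norm r \<ge> 1" "order r (jost_function a b p) \<ge> 1"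
  shows "r \<in> resonances a b p"
proof -
  obtain f where "jost_function a b p = cpoly f" "poly f 0 > 0"
    by (rule jost_polynomial_of_class[OF assms(1,2)]) blast
  thus ?thesis using assms(3,4) by (auto simp: resonances_def order_root)
qed

theorem corollary1p8:
  fixes a b :: "nat \<Rightarrow> real" and k p np nm :: nat and c :: pert_type and r\<^sub>o :: complex
  assumes "p \<ge> 1" and "k \<in> {2 * p - 1, 2 * p}"
    and "jacobi_class c k p np nm a b"
    and "r\<^sub>o \<in> resonances a b p"
  shows
    "(r\<^sub>o \<notin> \<real> \<longrightarrow> is_max_multiplicity c k p np nm (- \<real>) (M_nonreal c p np nm)) \<and>
     (r\<^sub>o \<in> \<real> \<longrightarrow> is_max_multiplicity c k p np nm \<real>
        (min (M_real c p np nm) (int k - (int np + int nm)))) \<and>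
     (r\<^sub>o \<notin> \<real> \<longrightarrow> (\<forall>w. w \<notin> \<real> \<union> cball 0 1 \<longrightarrow>
        (\<exists>a' b'. jacobi_class c k p np nm a' b' \<and> w \<in> resonances a' b' p \<and>
                 multiplicity_of a' b' p w = M_nonreal c p np nm))) \<and>
     (\<forall>s. enumerates_disc_roots a b p np nm s \<longrightarrow>
        (\<forall>j \<in> {- int nm + 1..-1} \<union> {2..int np}.
           \<exists>a' b' (t::real). jacobi_class c k p np nm a' b' \<and>
              enumerates_disc_roots a' b' p np nm s \<and>
              inverse (s j) < t \<and> t < inverse (s (j - 1)) \<and>
              of_real t \<in> resonances a' b' p \<and>
              multiplicity_of a' b' p (of_real t) = M_real c p np nm))"
proof -
  note p = assms(1) and k = assms(2) and cl = assms(3)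
  have t: "has_type c k p a b" using cl by (simp add: jacobi_class_def)
  note par = conjunct2[OF has_type_parity[OF p t]]
  let ?z = "forced_total c np nm"
  note bounds = multiplicity_bounds[OF p]
  define S where "S = {s :: real. of_real s \<in> disc_roots a b p}"
  note S = real_disc_roots[OF p cl, folded S_def]
  obtain R where R: "balanced_zeros c S R"
    and between: "\<And>s t. s \<in> S \<Longrightarrow> t \<in> S \<Longrightarrow> t < s \<Longrightarrow> s * t > 0 \<Longrightarrow> \<forall>u\<in>S. u \<le> t \<or> s \<le> u \<Longrightarrow>
      \<exists>r\<in>R. inverse s < r \<and> r < inverse t"
    using balanced_zeros_exist[OF S(1,2), of c] by metis
  have R1: "\<bar>r\<bar> > 1" if "r \<in> R" for r using that R by (auto simp: balanced_zeros_def)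
  have cardSR: "card (S \<union> R) = ?z" using R S(3,4) by (simp add: balanced_zeros_def)
  have cardS: "card S = np + nm"
  proof -
    have "S = {s\<in>S. s > 0} \<union> {s\<in>S. s < 0}" using S(2) by force
    moreover have "card ({s\<in>S. s > 0} \<union> {s\<in>S. s < 0}) = np + nm"
      unfolding S(3,4) using S(1) by (intro card_Un_disjoint) auto
    ultimately show ?thesis by simp
  qed
  have "?z \<le> k" by (rule bounds(1)[OF cl assms(4)])
  then obtain e where e: "k = ?z + 2 * e" using even_excess[OF par] by blast
  have ek: "card (S \<union> R) + 2 * e = k" using e cardSR by simp
  have Mn: "M_nonreal c p np nm = int e" using M_nonreal_eq[OF p t, of np nm] e by simp
  have nonreal: "\<exists>a' b'. jacobi_class c k p np nm a' b' \<and> w \<in> resonances a' b' p \<and>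
      multiplicity_of a' b' p w = M_nonreal c p np nm"
    if r: "r\<^sub>o \<notin> \<real>" and w: "w \<notin> \<real>" "norm w > 1" for w
  proof -
    have "e \<ge> 1" using bounds(2,3)[OF cl assms(4)] r e by simp
    obtain a' b' where H: "jacobi_class c k p np nm a' b'" "order w (jost_function a' b' p) = e"
      using nonreal_resonance_attained[OF p k par S(1,2) R ek w] S(3,4) by metis
    thus ?thesis using resonance_of_order[OF p H(1), of w] w(2) \<open>e \<ge> 1\<close> Mn
      by (auto simp: multiplicity_of_def)
  qed
  have max_nonreal: "is_max_multiplicity c k p np nm (- \<real>) (M_nonreal c p np nm)" if "r\<^sub>o \<notin> \<real>"
    unfolding is_max_multiplicity_def
  proof (intro conjI allI impI)
    \<comment> \<open>any nonreal point outside the closed disc would do\<close>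
    have "2 * \<i> \<notin> \<real>" "norm (2 * \<i>) > 1" by (auto simp: complex_is_Real_iff norm_mult)
    thus "\<exists>a b r. jacobi_class c k p np nm a b \<and> r \<in> resonances a b p \<inter> - \<real> \<and>
              multiplicity_of a b p r = M_nonreal c p np nm"
      using nonreal[OF that] by blast
    fix a' b' r assume "jacobi_class c k p np nm a' b' \<and> r \<in> resonances a' b' p \<inter> - \<real>"
    thus "multiplicity_of a' b' p r \<le> M_nonreal c p np nm"
      using bounds(3)[of c k np nm a' b' r] e Mn by (auto simp: multiplicity_of_def)
  qed
  have max_real: "is_max_multiplicity c k p np nm \<real> (min (M_real c p np nm) (int k - (int np + int nm)))"
    if "r\<^sub>o \<in> \<real>"
    unfolding is_max_multiplicity_def M_real_eq(1)[OF p t]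
  proof (intro conjI allI impI)
    fix a' b' r assume "jacobi_class c k p np nm a' b' \<and> r \<in> resonances a' b' p \<inter> \<real>"
    thus "multiplicity_of a' b' p r \<le> min (int k - int ?z + 1) (int k - (int np + int nm))"
      using bounds(4,5)[of c k np nm a' b' r] by (auto simp: multiplicity_of_def)
  next
    \<comment> \<open>A forced zero, or if there is none any point off the reciprocals of the zeros in the disc.\<close>
    have "\<exists>t. \<bar>t\<bar> > 1 \<and> (t \<in> R \<or> R = {} \<and> t \<notin> inverse ` S)"
    proof (cases "R = {}")
      case True
      have "infinite ({1<..} - inverse ` S)" using S(1) infinite_Ioi by (intro Diff_infinite_finite) auto
      then obtain t where "t \<in> {1<..} - inverse ` S" using infinite_imp_nonempty by blast
      thus ?thesis using True by (intro exI[of _ t]) auto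
    qed (use R1 in auto)
    then obtain t where tt: "\<bar>t\<bar> > 1" "t \<in> R \<or> R = {} \<and> t \<notin> inverse ` S" by blast
    obtain a' b' where H: "jacobi_class c k p np nm a' b'"
      "order (of_real t) (jost_function a' b' p) = 2 * e + (if t \<in> R then 1 else 0)"
      using real_resonance_attained[OF p k par S(1,2) R ek tt(1)] tt(2) S(3,4) by metis
    have "int (2 * e + (if t \<in> R then 1 else 0)) = min (int k - int ?z + 1) (int k - (int np + int nm))
        \<and> 2 * e + (if t \<in> R then 1 else 0) \<ge> 1"
    proof (cases "t \<in> R")
      case True
      have "card S < card (S \<union> R)"
      proof (rule psubset_card_mono)
        show "S \<subset> S \<union> R" using True R1[OF True] S(2) by force
      qed (use S(1) R in \<open>auto simp: balanced_zeros_def\<close>)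
      thus ?thesis using True e cardS cardSR by simp
    next
      case False
      hence "R = {}" using tt(2) by blast
      hence "?z = np + nm" using cardS cardSR by simp
      moreover have "np + nm < k" using bounds(2,5)[OF cl assms(4)] by simp
      ultimately show ?thesis using False e by simp
    qed
    thus "\<exists>a b r. jacobi_class c k p np nm a b \<and> r \<in> resonances a b p \<inter> \<real> \<and>
      multiplicity_of a b p r = min (int k - int ?z + 1) (int k - (int np + int nm))"
      using H resonance_of_order[OF p H(1), of "of_real t"] tt(1)
      by (intro exI[of _ a'] exI[of _ b'] exI[of _ "of_real t"]) (auto simp: multiplicity_of_def)
  qed
  have location: "\<exists>a' b' (t::real). jacobi_class c k p np nm a' b' \<and>
              enumerates_disc_roots a' b' p np nm s \<and>
              inverse (s j) < t \<and> t < inverse (s (j - 1)) \<and>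
              of_real t \<in> resonances a' b' p \<and>
              multiplicity_of a' b' p (of_real t) = M_real c p np nm"
    if en: "enumerates_disc_roots a b p np nm s" and j: "j \<in> {- int nm + 1..-1} \<union> {2..int np}" for s j
  proof -
    let ?I = "{- int nm..int np} - {0}"
    have mono: "strict_mono_on ?I s" and dr: "disc_roots a b p = (\<lambda>j. of_real (s j)) ` ?I"
      and sg: "\<forall>j\<in>{- int nm..-1}. s j < 0" "\<forall>j\<in>{1..int np}. 0 < s j"
      using en by (auto simp: enumerates_disc_roots_def)
    have S_eq: "S = s ` ?I" by (auto simp: S_def dr)
    have jI: "j \<in> ?I" "j - 1 \<in> ?I" using j by auto
    have lt: "s (j - 1) < s j" using mono jI by (auto simp: strict_mono_on_def)
    have "s j * s (j - 1) > 0" using j sg by (auto intro: mult_pos_pos mult_neg_neg)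
    moreover have "u \<le> s (j - 1) \<or> s j \<le> u" if uS: "u \<in> S" for u
    proof -
      obtain i where i: "i \<in> ?I" "u = s i" using uS unfolding S_eq by blast
      have "i \<le> j - 1 \<or> j \<le> i" by linarith
      thus ?thesis using strict_mono_on_leD[OF mono] i jI by blast
    qed
    ultimately obtain t where tR: "t \<in> R" "inverse (s j) < t" "t < inverse (s (j - 1))"
      using between[of "s j" "s (j - 1)"] lt jI S_eq by blast
    obtain a' b' where H: "jacobi_class c k p np nm a' b'" "disc_roots a' b' p = of_real ` S"
      "order (of_real t) (jost_function a' b' p) = 2 * e + (if t \<in> R then 1 else 0)"
      using real_resonance_attained[OF p k par S(1,2) R ek R1[OF tR(1)]] tR(1) S(3,4) by metis
    have "disc_roots a' b' p = disc_roots a b p" unfolding H(2) S_eq dr by (simp add: image_image)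
    hence "enumerates_disc_roots a' b' p np nm s" using en by (simp add: enumerates_disc_roots_def)
    moreover have "of_real t \<in> resonances a' b' p"
      using resonance_of_order[OF p H(1), of "of_real t"] H(3) tR(1) R1[OF tR(1)] by simp
    moreover have "multiplicity_of a' b' p (of_real t) = M_real c p np nm"
    proof -
      have "np + nm \<ge> 1" using j by auto
      thus ?thesis using M_real_eq(2)[OF p t] H(3) tR(1) e by (simp add: multiplicity_of_def)
    qed
    ultimately show ?thesis using H(1) tR(2,3) by blast
  qed
  show ?thesis using max_nonreal max_real nonreal location by (auto simp: not_le)
qed

end
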